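(* Let $(1,r,a,t)$ be a level $h$-vector, where $t\geq r-2$. Then $(1,r,b,t)$ is also a level $h$-vector for all integers $b=a,a+1,\dots,\min\left\lbrace r\cdot t,\binom{r+1}{2}\right\rbrace$, the upper bound being sharp (i.e. $(1,r,b,t)$ is not a level $h$-vector for $b>\min\lbrace r\cdot t,\binom{r+1}{2}\rbrace$).
   Context: Let $k$ be a field of characteristic zero. All algebras are standard graded artinian algebras $A=R/I$, where $R=k[x_1,\dots,x_r]$, all $x_i$ have degree $1$, and $I$ is a homogeneous ideal of $R$ containing no nonzero forms of degree $1$. The $h$-vector of $A$ is $h(A)=(h_0,h_1,\dots,h_e)$, where $h_i=\dim_k A_i$ and $e$ is the last index with $\dim_k A_e>0$; thus $h_0=1$ and $h_1=r$. The integer $e$ is the socle degree. The socle of $A$ is the annihilator in $A$ of its homogeneous maximal ideal. $A$ is level of type $t$ if its socle is concentrated in degree $e$ and has dimension $t=h_e$. An $h$-vector is level if it is the $h$-vector of some level standard graded artinian algebra $A=k[x_1,\dots,x_r]/I$, where all $x_i$ have degree $1$ and $I$ is a homogeneous ideal containing no nonzero forms of degree $1$. *)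

theory Defs
  imports "HOL-Algebra.QuotRing" "HOL-Algebra.Embedded_Algebras" "HOL-Library.Poly_Mapping"
begin

section \<open>The standard graded polynomial ring $k[x_0,\dots,x_{r-1}]$\<close>

text \<open>
  The field is a type \<open>'k :: field\<close>. A monomial is an exponent map \<^typ>\<open>nat \<Rightarrow>\<^sub>0 nat\<close>; a polynomial
  maps monomials to coefficients, and the product of \<^typ>\<open>('a \<Rightarrow>\<^sub>0 'b)\<close> is the convolution product.
  The number \<open>r\<close> of variables is a natural number, so the polynomial ring is a carrier set
  inside the ring of polynomials in countably many variables.
\<close>

type_synonym 'k mpoly = "(nat \<Rightarrow>\<^sub>0 nat) \<Rightarrow>\<^sub>0 'k"

definition mon_degree :: "(nat \<Rightarrow>\<^sub>0 nat) \<Rightarrow> nat" where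
  "mon_degree m = (\<Sum>i\<in>Poly_Mapping.keys m. Poly_Mapping.lookup m i)"

definition mpoly_ring :: "nat \<Rightarrow> ('k::field mpoly) ring" where
  "mpoly_ring r =
     \<lparr> carrier = {p. \<forall>m\<in>Poly_Mapping.keys p. Poly_Mapping.keys m \<subseteq> {..<r}},
       monoid.mult = (*), one = 1, zero = 0, add = (+) \<rparr>"

text \<open>The forms of degree \<open>d\<close>, with zero included.\<close>

definition forms :: "nat \<Rightarrow> nat \<Rightarrow> ('k::field mpoly) set" where
  "forms r d = {p \<in> carrier (mpoly_ring r). \<forall>m\<in>Poly_Mapping.keys p. mon_degree m = d}"

definition hom_component :: "nat \<Rightarrow> 'k::field mpoly \<Rightarrow> 'k mpoly" where
  "hom_component d p =
     (\<Sum>m\<in>{m \<in> Poly_Mapping.keys p. mon_degree m = d}.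
        Poly_Mapping.single m (Poly_Mapping.lookup p m))"

definition homogeneous_ideal :: "nat \<Rightarrow> ('k::field mpoly) set \<Rightarrow> bool" where
  "homogeneous_ideal r I \<longleftrightarrow>
     ideal I (mpoly_ring r) \<and> (\<forall>p\<in>I. \<forall>d. hom_component d p \<in> I)"


section \<open>The quotient algebra $A = R/I$\<close>

abbreviation quot_alg :: "nat \<Rightarrow> ('k::field mpoly) set \<Rightarrow> ('k mpoly set) ring" where
  "quot_alg r I \<equiv> mpoly_ring r Quot I"

abbreviation image_in_quot :: "nat \<Rightarrow> ('k::field mpoly) set \<Rightarrow> 'k mpoly set \<Rightarrow> ('k mpoly set) set" where
  "image_in_quot r I S \<equiv> (\<lambda>p. I +>\<^bsub>mpoly_ring r\<^esub> p) ` S"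

text \<open>The graded component $A_d$ is the image of $R_d$.\<close>

definition quot_component :: "nat \<Rightarrow> ('k::field mpoly) set \<Rightarrow> nat \<Rightarrow> ('k mpoly set) set" where
  "quot_component r I d = image_in_quot r I (forms r d)"

text \<open>The copy of the ground field inside $A$.\<close>

definition quot_scalars :: "nat \<Rightarrow> ('k::field mpoly) set \<Rightarrow> ('k mpoly set) set" where
  "quot_scalars r I = image_in_quot r I (range (Poly_Mapping.single 0))"

text \<open>The dimension over the ground field is the library's dimension over a subfield of a ring.
  It is a relation between \<open>n\<close> and \<open>E\<close>, so no value is assigned to infinite-dimensional \<open>E\<close>.\<close>

definition has_k_dim :: "nat \<Rightarrow> ('k::field mpoly) set \<Rightarrow> ('k mpoly set) set \<Rightarrow> nat \<Rightarrow> bool" where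
  "has_k_dim r I E n \<longleftrightarrow> ring.dimension (quot_alg r I) n (quot_scalars r I) E"

text \<open>The image in $A$ of the polynomials with zero constant term.\<close>

definition hom_max_ideal :: "nat \<Rightarrow> ('k::field mpoly) set \<Rightarrow> ('k mpoly set) set" where
  "hom_max_ideal r I =
     image_in_quot r I {p \<in> carrier (mpoly_ring r). Poly_Mapping.lookup p 0 = 0}"

definition socle :: "nat \<Rightarrow> ('k::field mpoly) set \<Rightarrow> ('k mpoly set) set" where
  "socle r I =
     {a \<in> carrier (quot_alg r I).
        \<forall>b\<in>hom_max_ideal r I. a \<otimes>\<^bsub>quot_alg r I\<^esub> b = \<zero>\<^bsub>quot_alg r I\<^esub>}"

definition artinian_ring :: "('a, 'b) ring_scheme \<Rightarrow> bool" where
  "artinian_ring A \<longleftrightarrow> cring A \<and>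
     (\<forall>J :: nat \<Rightarrow> 'a set. (\<forall>n. ideal (J n) A) \<and> (\<forall>n. J (Suc n) \<subseteq> J n)
        \<longrightarrow> (\<exists>N. \<forall>n\<ge>N. J n = J N))"

definition standard_graded_artinian :: "nat \<Rightarrow> ('k::field mpoly) set \<Rightarrow> bool" where
  "standard_graded_artinian r I \<longleftrightarrow>
     homogeneous_ideal r I \<and> I \<inter> forms r 1 = {0} \<and> artinian_ring (quot_alg r I)"

text \<open>The list \<open>h\<close> is $(h_0,\dots,h_e)$, so that $e$ is \<open>length h - 1\<close> and $h_e$ is \<open>last h\<close>.\<close>

definition has_h_vector :: "nat \<Rightarrow> ('k::field mpoly) set \<Rightarrow> nat list \<Rightarrow> bool" where
  "has_h_vector r I h \<longleftrightarrow>
     h \<noteq> [] \<and> last h > 0 \<and>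
     (\<forall>i<length h. has_k_dim r I (quot_component r I i) (h ! i)) \<and>
     (\<forall>i\<ge>length h. has_k_dim r I (quot_component r I i) 0)"

text \<open>With \<open>h\<close> the h-vector, the algebra is level of type $h_e$.\<close>

definition is_level :: "nat \<Rightarrow> ('k::field mpoly) set \<Rightarrow> nat list \<Rightarrow> bool" where
  "is_level r I h \<longleftrightarrow>
     socle r I \<subseteq> quot_component r I (length h - 1) \<and> has_k_dim r I (socle r I) (last h)"

definition level_h_vector :: "'k::field itself \<Rightarrow> nat list \<Rightarrow> bool" where
  "level_h_vector _ h \<longleftrightarrow>
     (\<exists>r. \<exists>I :: 'k mpoly set.
        standard_graded_artinian r I \<and> has_h_vector r I h \<and> is_level r I h)"

end

theory Submission
  imports Defs
begin

text \<open>
  A level algebra of socle degree 3 and type $t$ is determined by the $t$-dimensional space of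
  functionals on cubics that vanish on $I_3$: if $\phi_1, \dots, \phi_t$ is a basis, then a quadric
  $p$ lies in $I$ iff $\phi_j(x_i p) = 0$ for all $i, j$. Hence $b \le rt$, while
  $b \le \dim R_2 = \binom{r+1}{2}$ is clear.

  It suffices to raise $a$ by one below both bounds. Since $a < \dim R_2$, there is a nonzero quadric
  $p_0 \in I$; since $a < rt$, there is a nontrivial relation
  $\sum_{i,j} d_{ij} \phi_j(x_i p) = 0$ valid for all quadrics $p$, say with $d_{i j_0} \ne 0$ for some $i$.
  Choose a point $v$ at which neither $p_0$ nor the linear form $\sum_i d_{i j_0} x_i$ vanishes, and add
  evaluation at $v$ to $\phi_{j_0}$ (in terms of inverse systems: add the cube of a linear form to one
  generator). The relation shows that a quadric in the new ideal satisfies $p(v) = 0$, so that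
  the new quadrics are exactly the old ones vanishing at $v$, a subspace of codimension one because of
  $p_0$. Linear independence of the functionals and the absence of linear forms in the ideal
  are inherited.
\<close>

section \<open>Linear algebra modulo a subspace\<close>

text \<open>Gaussian elimination, one equation at a time: an equation that vanishes on
  \<open>X\<close> is dropped, any other is solved for an unknown \<open>z\<close> and substituted
  into the rest.\<close>

lemma underdetermined_system:
  fixes M :: "'y \<Rightarrow> 'x \<Rightarrow> 'k::field"
  assumes "finite Y" "finite X" "card Y < card X"
  shows "\<exists>d. (\<exists>x\<in>X. d x \<noteq> 0) \<and> (\<forall>y\<in>Y. (\<Sum>x\<in>X. d x * M y x) = 0)"
  using assms
proof (induction Y arbitrary: X M rule: finite_induct)
  case empty
  then have "\<exists>x. x \<in> X" by (metis card_gt_0_iff card.empty ex_in_conv)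
  then show ?case by (intro exI[of _ "\<lambda>_. 1"]) auto
next
  case (insert y Y)
  show ?case
  proof (cases "\<forall>x\<in>X. M y x = 0")
    case True
    have "card Y < card X" using insert by simp
    then obtain d where "\<exists>x\<in>X. d x \<noteq> 0" "\<forall>y\<in>Y. (\<Sum>x\<in>X. d x * M y x) = 0"
      using insert.IH[OF insert.prems(1), of M] by blast
    with True show ?thesis by (intro exI[of _ d]) auto
  next
    case False
    then obtain z where z: "z \<in> X" "M y z \<noteq> 0" by blast
    have "card Y < card (X - {z})" using insert z by simp
    then obtain d where d: "\<exists>x\<in>X - {z}. d x \<noteq> 0"
      and eq: "\<And>u. u \<in> Y \<Longrightarrow> (\<Sum>x\<in>X - {z}. d x * (M u x - M u z * M y x / M y z)) = 0"
      using insert.IH[of "X - {z}" "\<lambda>u x. M u x - M u z * M y x / M y z"] insert.prems(1) by auto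
    define s where "s = (\<Sum>x\<in>X - {z}. d x * M y x)"
    \<comment> \<open>Back substitution: this value at \<open>z\<close> is the one that solves
      equation \<open>y\<close>.\<close>
    define d' where "d' = d(z := - s / M y z)"
    have split: "(\<Sum>x\<in>X. d' x * M u x) = - s / M y z * M u z + (\<Sum>x\<in>X - {z}. d x * M u x)" for u
    proof -
      have "(\<Sum>x\<in>X - {z}. d' x * M u x) = (\<Sum>x\<in>X - {z}. d x * M u x)"
        by (rule sum.cong) (auto simp: d'_def)
      then show ?thesis
        using sum.remove[OF insert.prems(1) z(1), of "\<lambda>x. d' x * M u x"] by (simp add: d'_def)
    qed
    have "(\<Sum>x\<in>X. d' x * M u x) = 0" if "u \<in> insert y Y" for u
    proof (cases "u = y")
      case True
      then show ?thesis using z(2) by (simp add: split s_def)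
    next
      case False
      then have "0 = (\<Sum>x\<in>X - {z}. d x * (M u x - M u z * M y x / M y z))"
        using eq that by simp
      also have "\<dots> = (\<Sum>x\<in>X - {z}. d x * M u x - M u z / M y z * (d x * M y x))"
        by (rule sum.cong) (auto simp: algebra_simps)
      also have "\<dots> = (\<Sum>x\<in>X - {z}. d x * M u x) - M u z / M y z * s"
        by (simp only: sum_subtractf s_def sum_distrib_left)
      finally show ?thesis by (simp add: split)
    qed
    moreover have "\<exists>x\<in>X. d' x \<noteq> 0"
      using d by (metis DiffE fun_upd_other d'_def singletonI)
    ultimately show ?thesis by blast
  qed
qed

section \<open>Dimension and coordinates modulo a subspace\<close>

locale ambient_space = vector_space scale for scale :: "'a::field \<Rightarrow> 'b::ab_group_add \<Rightarrow> 'b" (infixr \<open>*s\<close> 75)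
begin

text \<open>Linearity is demanded on \<open>S\<close> only: the functionals used below include
  coordinate functions obtained by choice on one graded piece, with unspecified values
  elsewhere.\<close>

definition linear_form_on :: "'b set \<Rightarrow> ('b \<Rightarrow> 'a) \<Rightarrow> bool" where
  "linear_form_on S f \<longleftrightarrow>
     (\<forall>p\<in>S. \<forall>q\<in>S. f (p + q) = f p + f q) \<and> (\<forall>c. \<forall>p\<in>S. f (c *s p) = c * f p)"

lemma linear_form_onD:
  assumes "linear_form_on S f" "p \<in> S"
  shows "q \<in> S \<Longrightarrow> f (p + q) = f p + f q" "f (c *s p) = c * f p"
  using assms by (auto simp: linear_form_on_def)

lemma linear_form_on_sum:
  assumes f: "linear_form_on S f" and S: "subspace S" and "\<And>x. x \<in> X \<Longrightarrow> g x \<in> S"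
  shows "f (\<Sum>x\<in>X. c x *s g x) = (\<Sum>x\<in>X. c x * f (g x))"
proof -
  have f0: "f 0 = 0"
    using linear_form_onD(2)[OF f subspace_0[OF S], of 0] by simp
  show ?thesis using assms(3)
  proof (induction X rule: infinite_finite_induct)
    case (insert x X)
    have "(\<Sum>x\<in>X. c x *s g x) \<in> S"
      using insert by (intro subspace_sum[OF S] subspace_scale[OF S]) auto
    moreover have "c x *s g x \<in> S" "g x \<in> S"
      using insert by (auto intro: subspace_scale[OF S])
    ultimately show ?case
      using insert linear_form_onD[OF f] by simp
  qed (simp_all add: f0)
qed

lemma linear_form_on_diff:
  assumes f: "linear_form_on S f" and S: "subspace S" and "p \<in> S" "q \<in> S"
  shows "f (p - q) = f p - f q"
proof -
  have "f ((p - q) + q) = f (p - q) + f q"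
    using assms by (intro linear_form_onD(1)[OF f] subspace_diff[OF S])
  then show ?thesis by (simp add: algebra_simps)
qed

text \<open>The \<open>e i\<close> are representatives of a basis of S / (S \<inter> I), so that no
  quotient space has to be built.\<close>

definition basis_modulo :: "'b set \<Rightarrow> 'b set \<Rightarrow> nat \<Rightarrow> (nat \<Rightarrow> 'b) \<Rightarrow> bool" where
  "basis_modulo S I n e \<longleftrightarrow> (\<forall>i<n. e i \<in> S) \<and>
     (\<forall>c. (\<Sum>i<n. c i *s e i) \<in> I \<longrightarrow> (\<forall>i<n. c i = 0)) \<and>
     (\<forall>p\<in>S. \<exists>c. p - (\<Sum>i<n. c i *s e i) \<in> I)"

text \<open>\<open>quotient_dim S I n\<close> says that $S / (S \cap I)$ has dimension \<open>n\<close>.\<close>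

definition quotient_dim :: "'b set \<Rightarrow> 'b set \<Rightarrow> nat \<Rightarrow> bool" where
  "quotient_dim S I n \<longleftrightarrow> (\<exists>e. basis_modulo S I n e)"

lemma basis_moduloD:
  assumes "basis_modulo S I n e"
  shows "i < n \<Longrightarrow> e i \<in> S"
    "(\<Sum>i<n. c i *s e i) \<in> I \<Longrightarrow> i < n \<Longrightarrow> c i = 0"
    "p \<in> S \<Longrightarrow> \<exists>c. p - (\<Sum>i<n. c i *s e i) \<in> I"
  using assms by (simp_all add: basis_modulo_def)

lemma quotient_dimE:
  assumes "quotient_dim S I n"
  obtains e where "basis_modulo S I n e"
  using assms by (auto simp: quotient_dim_def)

text \<open>Linear combinations of the \<open>e i\<close> and the remainders lie in
  \<open>S\<close>, so membership in \<open>I\<close> and in \<open>J\<close> agrees for all of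
  them.\<close>

lemma quotient_dim_cong:
  assumes "subspace S" "I \<inter> S = J \<inter> S"
  shows "quotient_dim S I n \<longleftrightarrow> quotient_dim S J n"
proof -
  have "quotient_dim S J n" if "quotient_dim S I n" "I \<inter> S = J \<inter> S" for I J
  proof -
    from that(1) obtain e where "basis_modulo S I n e" by (rule quotient_dimE)
    note e = basis_moduloD[OF this]
    have sum: "(\<Sum>i<n. c i *s e i) \<in> S" for c
      using e(1) by (intro subspace_sum[OF assms(1)] subspace_scale[OF assms(1)]) auto
    have "\<forall>p\<in>S. \<exists>c. p - (\<Sum>i<n. c i *s e i) \<in> J"
      using e(3) sum that(2) subspace_diff[OF assms(1)] by blast
    moreover have "\<forall>c. (\<Sum>i<n. c i *s e i) \<in> J \<longrightarrow> (\<forall>i<n. c i = 0)"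
      using e(2) sum that(2) by blast
    ultimately show ?thesis
      unfolding quotient_dim_def basis_modulo_def using e(1) by blast
  qed
  then show ?thesis using assms(2) by metis
qed

text \<open>Steinitz bound for quotients: coordinates modulo \<open>I\<close> turn a relation among
  the \<open>f x\<close> into a homogeneous system with \<open>card Y\<close> equations and
  \<open>card X\<close> unknowns.\<close>

lemma dependent_modulo:
  assumes I: "subspace I" and "finite X" "finite Y" "card Y < card X"
    and span: "\<And>x. x \<in> X \<Longrightarrow> \<exists>c. f x - (\<Sum>y\<in>Y. c y *s e y) \<in> I"
  shows "\<exists>d. (\<exists>x\<in>X. d x \<noteq> 0) \<and> (\<Sum>x\<in>X. d x *s f x) \<in> I"
proof -
  from span obtain c where c: "\<And>x. x \<in> X \<Longrightarrow> f x - (\<Sum>y\<in>Y. c x y *s e y) \<in> I"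
    by metis
  obtain d where d: "\<exists>x\<in>X. d x \<noteq> 0" "\<forall>y\<in>Y. (\<Sum>x\<in>X. d x * c x y) = 0"
    using underdetermined_system[of Y X "\<lambda>y x. c x y"] assms(2-4) by auto
  have "(\<Sum>x\<in>X. d x *s (f x - (\<Sum>y\<in>Y. c x y *s e y))) \<in> I"
    using c by (intro subspace_sum[OF I] subspace_scale[OF I]) auto
  also have "(\<Sum>x\<in>X. d x *s (f x - (\<Sum>y\<in>Y. c x y *s e y)))
      = (\<Sum>x\<in>X. d x *s f x) - (\<Sum>x\<in>X. \<Sum>y\<in>Y. (d x * c x y) *s e y)"
    by (simp add: scale_right_diff_distrib scale_sum_right sum_subtractf)
  also have "(\<Sum>x\<in>X. \<Sum>y\<in>Y. (d x * c x y) *s e y) = (\<Sum>y\<in>Y. (\<Sum>x\<in>X. d x * c x y) *s e y)"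
    by (subst sum.swap) (simp add: scale_sum_left)
  finally show ?thesis using d by auto
qed

text \<open>The last clause presents \<open>I\<close> inside \<open>S\<close> as the common kernel
  of the \<open>\<phi> i\<close>; this is how an ideal is turned into an inverse system.\<close>

definition dual_basis :: "'b set \<Rightarrow> 'b set \<Rightarrow> nat \<Rightarrow> (nat \<Rightarrow> 'b) \<Rightarrow> (nat \<Rightarrow> 'b \<Rightarrow> 'a) \<Rightarrow> bool" where
  "dual_basis S I n e \<phi> \<longleftrightarrow> (\<forall>i<n. e i \<in> S \<and> linear_form_on S (\<phi> i)) \<and>
     (\<forall>i<n. \<forall>j<n. \<phi> i (e j) = (if i = j then 1 else 0)) \<and>
     (\<forall>p\<in>S. p \<in> I \<longleftrightarrow> (\<forall>i<n. \<phi> i p = 0))"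

lemma dual_basisD:
  assumes "dual_basis S I n e \<phi>"
  shows "i < n \<Longrightarrow> e i \<in> S" "i < n \<Longrightarrow> linear_form_on S (\<phi> i)"
    "i < n \<Longrightarrow> j < n \<Longrightarrow> \<phi> i (e j) = (if i = j then 1 else 0)"
    "p \<in> S \<Longrightarrow> p \<in> I \<longleftrightarrow> (\<forall>i<n. \<phi> i p = 0)"
  using assms unfolding dual_basis_def by blast+

text \<open>The \<open>\<phi> i\<close> are the coordinates with respect to a basis modulo
  \<open>I\<close>.\<close>

lemma quotient_dim_imp_dual_basis:
  assumes S: "subspace S" and I: "subspace I" and "quotient_dim S I n"
  shows "\<exists>e \<phi>. dual_basis S I n e \<phi>"
proof -
  from assms(3) obtain e where basis: "basis_modulo S I n e" by (rule quotient_dimE)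
  note e = basis_moduloD(1)[OF basis] and ind = basis_moduloD(2)[OF basis] and span = basis_moduloD(3)[OF basis]
  from span obtain \<psi> where \<psi>: "\<And>p. p \<in> S \<Longrightarrow> p - (\<Sum>i<n. \<psi> p i *s e i) \<in> I"
    by metis
  \<comment> \<open>Choice only supplies some coefficients. Independence makes them unique, so
    linearity and duality follow by exhibiting an expansion of the right form.\<close>
  have unique: "\<psi> p i = c i" if "p \<in> S" "i < n" "p - (\<Sum>i<n. c i *s e i) \<in> I" for p c i
  proof -
    have "(p - (\<Sum>i<n. c i *s e i)) - (p - (\<Sum>i<n. \<psi> p i *s e i)) \<in> I"
      by (rule subspace_diff[OF I that(3) \<psi>[OF that(1)]])
    then have "(\<Sum>i<n. (\<psi> p i - c i) *s e i) \<in> I"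
      by (simp add: scale_left_diff_distrib sum_subtractf)
    then show ?thesis using ind[of "\<lambda>i. \<psi> p i - c i"] that by simp
  qed
  have "linear_form_on S (\<lambda>p. \<psi> p i)" if "i < n" for i
    unfolding linear_form_on_def
  proof (intro conjI ballI allI)
    fix p q assume pq: "p \<in> S" "q \<in> S"
    have "(p - (\<Sum>i<n. \<psi> p i *s e i)) + (q - (\<Sum>i<n. \<psi> q i *s e i)) \<in> I"
      using pq \<psi> by (intro subspace_add[OF I]) auto
    then have "(p + q) - (\<Sum>i<n. (\<psi> p i + \<psi> q i) *s e i) \<in> I"
      by (simp add: scale_left_distrib sum.distrib algebra_simps)
    then show "\<psi> (p + q) i = \<psi> p i + \<psi> q i"
      by (rule unique[OF subspace_add[OF S pq] that])
  next
    fix c p assume p: "p \<in> S"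
    have "c *s (p - (\<Sum>i<n. \<psi> p i *s e i)) \<in> I"
      using p \<psi> by (intro subspace_scale[OF I]) auto
    then have "c *s p - (\<Sum>i<n. (c * \<psi> p i) *s e i) \<in> I"
      by (simp add: scale_right_diff_distrib scale_sum_right)
    then show "\<psi> (c *s p) i = c * \<psi> p i"
      by (rule unique[OF subspace_scale[OF S p] that])
  qed
  moreover have "\<psi> (e j) i = (if i = j then 1 else 0)" if "i < n" "j < n" for i j
  proof (rule unique)
    have "(\<Sum>i<n. (if i = j then 1 else 0) *s e i) = (\<Sum>i<n. if i = j then e i else 0)"
      by (rule sum.cong) auto
    then show "e j - (\<Sum>i<n. (if i = j then 1 else 0) *s e i) \<in> I"
      using that subspace_0[OF I] by simp
  qed (use that e in auto)
  moreover have "p \<in> I \<longleftrightarrow> (\<forall>i<n. \<psi> p i = 0)" if "p \<in> S" for p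
  proof
    assume "p \<in> I"
    then show "\<forall>i<n. \<psi> p i = 0"
      using unique[of p _ "\<lambda>_. 0"] that by simp
  next
    assume "\<forall>i<n. \<psi> p i = 0"
    then show "p \<in> I" using \<psi>[OF that] by simp
  qed
  ultimately have "dual_basis S I n e (\<lambda>i p. \<psi> p i)"
    using e unfolding dual_basis_def by simp
  then show ?thesis by blast
qed

text \<open>The remainder has all coordinates zero, hence lies in the common kernel.\<close>

lemma dual_basis_expand:
  assumes S: "subspace S" and e: "dual_basis S I n e \<phi>" and p: "p \<in> S"
  shows "p - (\<Sum>i<n. \<phi> i p *s e i) \<in> I"
    and "j < n \<Longrightarrow> \<phi> j (\<Sum>i<n. c i *s e i) = c j"
proof -
  note d = dual_basisD[OF e]
  show coord: "\<phi> j (\<Sum>i<n. c i *s e i) = c j" if "j < n" for j c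
  proof -
    have "\<phi> j (\<Sum>i<n. c i *s e i) = (\<Sum>i<n. c i * \<phi> j (e i))"
      using d(1) by (intro linear_form_on_sum[OF d(2)[OF that] S]) auto
    also have "\<dots> = (\<Sum>i<n. if i = j then c i else 0)"
      using that by (intro sum.cong) (auto simp: d(3))
    finally show ?thesis using that by simp
  qed
  have sum: "(\<Sum>i<n. \<phi> i p *s e i) \<in> S"
    using d(1) by (intro subspace_sum[OF S] subspace_scale[OF S]) auto
  have "\<phi> j (p - (\<Sum>i<n. \<phi> i p *s e i)) = 0" if "j < n" for j
    using linear_form_on_diff[OF d(2)[OF that] S p sum] coord[OF that] by simp
  then show "p - (\<Sum>i<n. \<phi> i p *s e i) \<in> I"
    using d(4)[OF subspace_diff[OF S p sum]] by simp
qed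

lemma dual_basis_imp_quotient_dim:
  assumes S: "subspace S" and e: "dual_basis S I n e \<phi>"
  shows "quotient_dim S I n"
proof -
  note d = dual_basisD[OF e]
  have sum: "(\<Sum>i<n. c i *s e i) \<in> S" for c
    using d(1) by (intro subspace_sum[OF S] subspace_scale[OF S]) auto
  show ?thesis unfolding quotient_dim_def basis_modulo_def
  proof (intro exI[of _ e] conjI allI impI ballI)
    fix c i assume "(\<Sum>i<n. c i *s e i) \<in> I" "i < n"
    then show "c i = 0"
      using dual_basis_expand(2)[OF S e subspace_0[OF S]] d(4)[OF sum] by metis
  next
    fix p assume "p \<in> S"
    then show "\<exists>c. p - (\<Sum>i<n. c i *s e i) \<in> I"
      using dual_basis_expand(1)[OF S e] by (intro exI[of _ "\<lambda>i. \<phi> i p"])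
  next
    fix i assume "i < n"
    then show "e i \<in> S" by (rule d(1))
  qed
qed

text \<open>A chain that never stabilizes yields families of every length that are independent
  modulo \<open>I\<close>, against the finite spanning family indexed by \<open>Y\<close>.\<close>

lemma descending_chain_stabilizes:
  assumes J: "\<And>n. subspace (J n)" "\<And>n. J (Suc n) \<subseteq> J n" "\<And>n. J n \<subseteq> S"
    and I: "subspace I" "\<And>n. I \<subseteq> J n"
    and Y: "finite Y" and span: "\<And>p. p \<in> S \<Longrightarrow> \<exists>c. p - (\<Sum>y\<in>Y. c y *s e y) \<in> I"
  shows "\<exists>n. \<forall>m\<ge>n. J m = J n"
proof (rule ccontr)
  assume "\<not> ?thesis"
  then have drop: "\<exists>m\<ge>n. J m \<noteq> J n" for n by blast
  have anti: "J m \<subseteq> J n" if "n \<le> m" for m n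
    using J(2) that by (rule lift_Suc_antimono_le)
  \<comment> \<open>The new vector is taken outside a later member \<open>J m\<close> that contains
    the \<open>k\<close> vectors from the induction hypothesis, so \<open>n\<close> must stay
    general.\<close>
  have "\<exists>v. (\<forall>i<k. v i \<in> J n) \<and> (\<forall>c. (\<Sum>i<k. c i *s v i) \<in> I \<longrightarrow> (\<forall>i<k. c i = 0))" for k n :: nat
  proof (induction k arbitrary: n)
    case (Suc k)
    obtain m where m: "m \<ge> n" "J m \<noteq> J n" using drop by blast
    then obtain w where w: "w \<in> J n" "w \<notin> J m" using anti by blast
    obtain v where v: "\<And>i. i < k \<Longrightarrow> v i \<in> J m"
      "\<And>c. (\<Sum>i<k. c i *s v i) \<in> I \<Longrightarrow> \<forall>i<k. c i = 0"
      using Suc[of m] by blast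
    have "\<forall>i<Suc k. c i = 0" if "(\<Sum>i<Suc k. c i *s (v(k := w)) i) \<in> I" for c
    proof -
      have eq: "(\<Sum>i<k. c i *s v i) + c k *s w \<in> I" using that by simp
      have "(\<Sum>i<k. c i *s v i) \<in> J m"
        using v(1) by (intro subspace_sum[OF J(1)] subspace_scale[OF J(1)]) auto
      with eq have "((\<Sum>i<k. c i *s v i) + c k *s w) - (\<Sum>i<k. c i *s v i) \<in> J m"
        using I(2) by (intro subspace_diff[OF J(1)]) auto
      then have cw: "c k *s w \<in> J m" by simp
      have "c k = 0"
      proof (rule ccontr)
        assume "c k \<noteq> 0"
        then have "w = inverse (c k) *s (c k *s w)" by simp
        with w(2) cw show False using subspace_scale[OF J(1)] by metis
      qed
      then show ?thesis using eq v(2) by (simp add: less_Suc_eq)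
    qed
    moreover have "\<forall>i<Suc k. (v(k := w)) i \<in> J n"
      using v(1) w(1) anti[OF m(1)] by (auto simp: less_Suc_eq)
    ultimately show ?case by blast
  qed simp
  from this[where k = "Suc (card Y)" and n = 0] obtain v where v: "\<And>i. i < Suc (card Y) \<Longrightarrow> v i \<in> J 0"
    "\<And>c. (\<Sum>i<Suc (card Y). c i *s v i) \<in> I \<Longrightarrow> \<forall>i<Suc (card Y). c i = 0" by blast
  have "\<exists>d. (\<exists>x\<in>{..<Suc (card Y)}. d x \<noteq> 0) \<and> (\<Sum>x\<in>{..<Suc (card Y)}. d x *s v x) \<in> I"
    using span subsetD[OF J(3) v(1)] Y by (intro dependent_modulo[OF I(1), where Y = Y and e = e]) auto
  with v(2) show False by blast
qed

text \<open>Inside \<open>I\<close>, the kernel of \<open>f\<close> is a hyperplane because of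
  \<open>w\<close>; \<open>f\<close> therefore serves as one additional coordinate on
  \<open>S\<close> modulo \<open>J\<close>.\<close>

lemma quotient_dim_Suc:
  assumes S: "subspace S" and I: "subspace I" and dim: "quotient_dim S I n"
    and f: "linear_form_on S f" and w: "w \<in> S" "w \<in> I" "f w \<noteq> 0"
    and J: "\<And>p. p \<in> S \<Longrightarrow> p \<in> J \<longleftrightarrow> p \<in> I \<and> f p = 0"
  shows "quotient_dim S J (Suc n)"
proof -
  obtain e \<phi> where "dual_basis S I n e \<phi>"
    using quotient_dim_imp_dual_basis[OF S I dim] by blast
  note d = dual_basisD[OF this]
  \<comment> \<open>A multiple of \<open>w\<close> is dual to \<open>f\<close>; the old vectors are
    shifted along \<open>w\<close> until \<open>f\<close> vanishes on them. As \<open>w\<close> lies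
    in \<open>I\<close>, the shift leaves the old coordinates unchanged.\<close>
  define e' where "e' i = (if i = n then (1 / f w) *s w else e i - (f (e i) / f w) *s w)" for i
  define \<phi>' where "\<phi>' i = (if i = n then f else \<phi> i)" for i
  have cw: "c *s w \<in> S" for c using w(1) by (rule subspace_scale[OF S])
  have \<phi>w: "\<phi> i w = 0" if "i < n" for i using d(4)[OF w(1)] w(2) that by blast
  have "dual_basis S J (Suc n) e' \<phi>'"
    unfolding dual_basis_def
  proof (intro conjI allI impI ballI)
    fix i assume "i < Suc n"
    then show "e' i \<in> S" using d(1) cw by (auto simp: e'_def less_Suc_eq intro: subspace_diff[OF S])
  next
    fix i assume "i < Suc n"
    then show "linear_form_on S (\<phi>' i)" using f d(2) by (auto simp: \<phi>'_def less_Suc_eq)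
  next
    fix i j assume ij: "i < Suc n" "j < Suc n"
    have g: "g (e' j) = (if j = n then g w / f w else g (e j) - f (e j) / f w * g w)"
      if "linear_form_on S g" for g
    proof (cases "j = n")
      case True
      then show ?thesis using linear_form_onD(2)[OF that w(1), of "1 / f w"] by (simp add: e'_def)
    next
      case False
      then have "e j \<in> S" using ij(2) d(1) by (simp add: less_Suc_eq)
      then show ?thesis
        using False linear_form_onD(2)[OF that w(1)] linear_form_on_diff[OF that S _ cw]
        by (simp add: e'_def)
    qed
    show "\<phi>' i (e' j) = (if i = j then 1 else 0)"
    proof (cases "i = n")
      case True
      then show ?thesis using g[OF f] w(3) by (simp add: \<phi>'_def)
    next
      case False
      then have i: "i < n" using ij(1) by simp
      have "\<phi>' i (e' j) = (if j = n then 0 else \<phi> i (e j))"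
        using g[OF d(2)[OF i]] \<phi>w[OF i] i by (simp add: \<phi>'_def)
      then show ?thesis using d(3)[OF i, of j] i ij(2) by (auto simp: less_Suc_eq)
    qed
  next
    fix p assume p: "p \<in> S"
    show "p \<in> J \<longleftrightarrow> (\<forall>i<Suc n. \<phi>' i p = 0)"
      unfolding J[OF p] d(4)[OF p] by (auto simp: \<phi>'_def less_Suc_eq)
  qed
  then show ?thesis by (rule dual_basis_imp_quotient_dim[OF S])
qed

end

section \<open>Polynomials\<close>

abbreviation keys :: "('a \<Rightarrow>\<^sub>0 'b::zero) \<Rightarrow> 'a set" where "keys \<equiv> Poly_Mapping.keys"
abbreviation lookup :: "('a \<Rightarrow>\<^sub>0 'b::zero) \<Rightarrow> 'a \<Rightarrow> 'b" where "lookup \<equiv> Poly_Mapping.lookup"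
abbreviation single :: "'a \<Rightarrow> 'b::zero \<Rightarrow> 'a \<Rightarrow>\<^sub>0 'b" where "single \<equiv> Poly_Mapping.single"

text \<open>Scalars act as constant polynomials, in line with \<open>quot_scalars\<close>, which is
  the image of the constants.\<close>

definition smul :: "'k::field \<Rightarrow> 'k mpoly \<Rightarrow> 'k mpoly" where
  "smul c p = single 0 c * p"

definition var :: "nat \<Rightarrow> 'k::field mpoly" where
  "var i = single (single i 1) 1"

lemma lookup_smul [simp]: "lookup (smul c p) m = c * lookup p m"
  unfolding smul_def mult_map_scale_conv_mult[symmetric] by (simp add: Poly_Mapping.map.rep_eq when_def)

global_interpretation mp: ambient_space "smul :: 'k::field \<Rightarrow> 'k mpoly \<Rightarrow> 'k mpoly"
  by unfold_locales (auto intro!: poly_mapping_eqI simp: lookup_add algebra_simps)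

lemma smul_mult_left: "smul c p * q = smul c (p * q)"
  by (simp add: smul_def mult.assoc)

lemma smul_mult_right: "p * smul c q = smul c (p * q)"
  by (simp add: smul_def mult.left_commute)

lemma smul_single: "smul c (single m d) = single m (c * d)"
  by (simp add: smul_def mult_single)

lemma sum_single_lookup: "(\<Sum>m\<in>keys p. single m (lookup p m)) = p"
proof (rule poly_mapping_eqI)
  fix k
  have "lookup (\<Sum>m\<in>keys p. single m (lookup p m)) k = (\<Sum>m\<in>keys p. lookup p m when m = k)"
    by (simp add: lookup_sum lookup_single)
  also have "\<dots> = lookup p k"
    by (auto simp: when_def in_keys_iff)
  finally show "lookup (\<Sum>m\<in>keys p. single m (lookup p m)) k = lookup p k" .
qed

section \<open>Supports and degrees of monomials\<close>

lemma keys_add_exponent: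
  fixes m n :: "nat \<Rightarrow>\<^sub>0 nat"
  shows "keys (m + n) = keys m \<union> keys n"
  by (auto simp: in_keys_iff lookup_add)

lemma mon_degree_add: "mon_degree (m + n) = mon_degree m + mon_degree n"
  unfolding mon_degree_def by (rule setsum_keys_plus_distrib[of "\<lambda>_ x. x"]) auto

lemma mon_degree_single [simp]: "mon_degree (single i d) = d"
  by (simp add: mon_degree_def)

lemma mon_degree_zero [simp]: "mon_degree 0 = 0"
  by (simp add: mon_degree_def)

lemma mon_degree_eq_0_iff: "mon_degree m = 0 \<longleftrightarrow> m = 0"
proof
  assume "mon_degree m = 0"
  then have "keys m = {}"
    by (auto simp: mon_degree_def simp del: keys_eq_empty)
  then show "m = 0" by simp
qed simp

text \<open>Peels off one variable: this exhibits a monomial of positive degree as a multiple of a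
  variable, and, applied repeatedly, identifies the monomials of degrees one and two.\<close>

lemma exponent_split:
  assumes "m \<noteq> 0"
  obtains i n where "i \<in> keys m" "m = single i 1 + n" "keys n \<subseteq> keys m"
    "mon_degree m = Suc (mon_degree n)"
proof -
  obtain i where i: "i \<in> keys m" using assms by (metis ex_in_conv keys_eq_empty)
  have "m = single i 1 + (m - single i 1)"
    using i by (intro poly_mapping_eqI)
      (auto simp: lookup_add lookup_single minus_poly_mapping.rep_eq when_def in_keys_iff)
  moreover from this have "keys (m - single i 1) \<subseteq> keys m" "mon_degree m = Suc (mon_degree (m - single i 1))"
    by (metis keys_add_exponent Un_upper2, metis mon_degree_add mon_degree_single plus_1_eq_Suc)
  ultimately show thesis using that i by blast
qed

section \<open>Homogeneous components\<close>

lemma hom_component_lookup [simp]: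
  "lookup (hom_component d p) m = (if mon_degree m = d then lookup p m else 0)"
proof -
  have "lookup (hom_component d p) m
      = (\<Sum>n\<in>{n \<in> keys p. mon_degree n = d}. if n = m then lookup p n else 0)"
    unfolding hom_component_def by (auto simp: lookup_sum lookup_single when_def intro!: sum.cong)
  then show ?thesis by (simp add: in_keys_iff)
qed

lemma hom_component_add: "hom_component d (p + q) = hom_component d p + hom_component d q"
  by (rule poly_mapping_eqI) (simp add: lookup_add)

lemma hom_component_diff: "hom_component d (p - q) = hom_component d p - hom_component d q"
  by (rule poly_mapping_eqI) (simp add: lookup_minus)

lemma hom_component_smul: "hom_component d (smul c p) = smul c (hom_component d p)"
  by (rule poly_mapping_eqI) simp

lemma hom_component_sum: "hom_component d (\<Sum>x\<in>X. g x) = (\<Sum>x\<in>X. hom_component d (g x))"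
  by (rule poly_mapping_eqI) (simp add: lookup_sum)

lemma hom_component_zero [simp]: "hom_component d 0 = 0"
  by (rule poly_mapping_eqI) simp

lemma hom_component_form:
  assumes "q \<in> forms r d"
  shows "hom_component n q = (if n = d then q else 0)"
  using assms by (intro poly_mapping_eqI) (auto simp: forms_def in_keys_iff)

section \<open>The polynomial ring and its graded pieces\<close>

abbreviation polys :: "nat \<Rightarrow> 'k::field mpoly set" where
  "polys r \<equiv> carrier (mpoly_ring r)"

lemma polys_iff: "p \<in> polys r \<longleftrightarrow> (\<forall>m\<in>keys p. keys m \<subseteq> {..<r})"
  by (simp add: mpoly_ring_def)

lemma mpoly_ring_simps [simp]:
  "mult (mpoly_ring r) = (*)" "one (mpoly_ring r) = 1"
  "zero (mpoly_ring r) = 0" "add (mpoly_ring r) = (+)"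
  by (simp_all add: mpoly_ring_def)

lemma polys_add: "p \<in> polys r \<Longrightarrow> q \<in> polys r \<Longrightarrow> p + q \<in> polys r"
  using keys_add by (fastforce simp: polys_iff)

lemma polys_mult: "p \<in> polys r \<Longrightarrow> q \<in> polys r \<Longrightarrow> p * q \<in> polys r"
  using keys_mult[of p q] by (fastforce simp: polys_iff keys_add_exponent)

lemma polys_uminus: "p \<in> polys r \<Longrightarrow> - p \<in> polys r"
  by (auto simp: polys_iff in_keys_iff)

lemma polys_single: "single m c \<in> polys r \<longleftrightarrow> c = 0 \<or> keys m \<subseteq> {..<r}"
  by (auto simp: polys_iff)

lemma polys_hom_component: "p \<in> polys r \<Longrightarrow> hom_component d p \<in> polys r"
  by (auto simp: polys_iff in_keys_iff split: if_splits)

lemma polys_0 [simp]: "0 \<in> polys r" and polys_1 [simp]: "1 \<in> polys r"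
  by (auto simp: polys_iff)

lemma cring_mpoly_ring: "cring (mpoly_ring r :: 'k::field mpoly ring)"
proof (rule cringI)
  show "abelian_group (mpoly_ring r :: 'k mpoly ring)"
  proof (rule abelian_groupI)
    fix p :: "'k mpoly" assume "p \<in> polys r"
    then show "\<exists>q\<in>polys r. q \<oplus>\<^bsub>mpoly_ring r\<^esub> p = \<zero>\<^bsub>mpoly_ring r\<^esub>"
      by (intro bexI[of _ "- p"]) (simp_all add: polys_uminus)
  qed (auto simp: polys_add algebra_simps)
  show "comm_monoid (mpoly_ring r :: 'k mpoly ring)"
    by (rule comm_monoidI) (auto simp: polys_mult algebra_simps)
qed (auto simp: algebra_simps)

lemma ring_mpoly_ring: "ring (mpoly_ring r)"
  by (rule cring.axioms(1)[OF cring_mpoly_ring])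

lemma subspace_polys: "mp.subspace (polys r)"
  by (rule mp.subspaceI) (auto intro: polys_add polys_mult simp: smul_def polys_single)

lemma formsI: "p \<in> polys r \<Longrightarrow> (\<And>m. m \<in> keys p \<Longrightarrow> mon_degree m = d) \<Longrightarrow> p \<in> forms r d"
  by (simp add: forms_def)

lemma forms_polys: "p \<in> forms r d \<Longrightarrow> p \<in> polys r"
  by (simp add: forms_def)

lemma hom_component_forms: "p \<in> polys r \<Longrightarrow> hom_component d p \<in> forms r d"
  by (rule formsI[OF polys_hom_component]) (auto simp: in_keys_iff split: if_splits)

lemma forms_iff: "p \<in> forms r d \<longleftrightarrow> p \<in> polys r \<and> hom_component d p = p"
  by (metis forms_polys hom_component_form hom_component_forms)

lemma subspace_forms: "mp.subspace (forms r d)"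
  by (rule mp.subspaceI)
    (auto simp: forms_iff hom_component_add hom_component_smul polys_add mp.subspace_scale[OF subspace_polys])

lemma forms_mult: "p \<in> forms r d \<Longrightarrow> q \<in> forms r d' \<Longrightarrow> n = d + d' \<Longrightarrow> p * q \<in> forms r n"
  using keys_mult[of p q]
  by (intro formsI polys_mult) (fastforce simp: forms_def mon_degree_add)+

lemma var_forms: "i < r \<Longrightarrow> var i \<in> forms r 1"
  by (rule formsI) (auto simp: var_def polys_iff)

lemma one_forms: "1 \<in> forms r 0"
  by (rule formsI) auto

lemma forms_0D:
  assumes "p \<in> forms r 0"
  shows "p = smul (lookup p 0) 1"
proof (rule poly_mapping_eqI)
  fix m
  show "lookup p m = lookup (smul (lookup p 0) 1) m"
    using assms mon_degree_eq_0_iff[of m]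
    by (cases "m = 0") (force simp: forms_def lookup_one in_keys_iff)+
qed

text \<open>Multiplication by a form of degree \<open>d\<close> shifts degrees by \<open>d\<close>;
  this is checked on the monomials of \<open>f\<close> and summed. The case distinction keeps
  truncated subtraction from reading \<open>n - d\<close> as 0 when \<open>n < d\<close>.\<close>

lemma hom_component_mult_form:
  assumes q: "q \<in> forms r d"
  shows "hom_component n (f * q) = (if d \<le> n then hom_component (n - d) f * q else 0)"
proof -
  have deg: "mon_degree k = mon_degree m + d" if "k \<in> keys (single m c * q)" for m k and c :: 'a
    using that keys_mult[of "single m c" q] q by (fastforce simp: forms_def mon_degree_add split: if_splits)
  have mono: "hom_component n (single m c * q)
      = (if d \<le> n then hom_component (n - d) (single m c) else 0) * q" for m and c :: 'a
  proof (cases "mon_degree m + d = n")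
    case True
    then have "hom_component n (single m c * q) = single m c * q"
      using deg by (intro poly_mapping_eqI) (force simp: in_keys_iff)
    moreover have "hom_component (n - d) (single m c) = single m c"
      using True by (intro poly_mapping_eqI) (auto simp: lookup_single when_def)
    ultimately show ?thesis using True by auto
  next
    case False
    then have "hom_component n (single m c * q) = 0"
      using deg by (intro poly_mapping_eqI) (force simp: in_keys_iff)
    moreover have "hom_component (n - d) (single m c) = 0" if "d \<le> n"
      using False that by (intro poly_mapping_eqI) (auto simp: lookup_single when_def)
    ultimately show ?thesis by auto
  qed
  have "hom_component n (f * q) = (\<Sum>m\<in>keys f. hom_component n (single m (lookup f m) * q))"
    by (subst sum_single_lookup[of f, symmetric]) (simp only: sum_distrib_right hom_component_sum)
  also have "\<dots> = (if d \<le> n then (\<Sum>m\<in>keys f. hom_component (n - d) (single m (lookup f m))) * q else 0)"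
    by (simp add: mono sum_distrib_right)
  finally show ?thesis
    by (simp add: hom_component_sum[symmetric] sum_single_lookup)
qed

subsection \<open>Evaluation\<close>

definition eval_mon :: "(nat \<Rightarrow> 'k::field) \<Rightarrow> (nat \<Rightarrow>\<^sub>0 nat) \<Rightarrow> 'k" where
  "eval_mon v m = (\<Prod>i\<in>keys m. v i ^ lookup m i)"

definition eval_poly :: "(nat \<Rightarrow> 'k::field) \<Rightarrow> 'k mpoly \<Rightarrow> 'k" where
  "eval_poly v p = (\<Sum>m\<in>keys p. lookup p m * eval_mon v m)"

lemma eval_mon_add: "eval_mon v (m + n) = eval_mon v m * eval_mon v n"
proof -
  \<comment> \<open>All products can run over one common support, since absent variables contribute
    \<open>v i ^ 0 = 1\<close>.\<close>
  have *: "eval_mon v m = (\<Prod>i\<in>A. v i ^ lookup m i)" if "finite A" "keys m \<subseteq> A" for m A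
    unfolding eval_mon_def using that by (intro prod.mono_neutral_left) (auto simp: in_keys_iff)
  show ?thesis
    using *[of "keys m \<union> keys n" m] *[of "keys m \<union> keys n" n] *[of "keys m \<union> keys n" "m + n"]
    by (simp add: keys_add_exponent lookup_add power_add prod.distrib)
qed

lemma eval_poly_add: "eval_poly v (p + q) = eval_poly v p + eval_poly v q"
  unfolding eval_poly_def
  by (rule setsum_keys_plus_distrib[of "\<lambda>m c. c * eval_mon v m"]) (auto simp: algebra_simps)

lemma eval_poly_zero [simp]: "eval_poly v 0 = 0"
  by (simp add: eval_poly_def)

lemma eval_poly_sum: "eval_poly v (\<Sum>x\<in>X. g x) = (\<Sum>x\<in>X. eval_poly v (g x))"
  by (induction X rule: infinite_finite_induct) (auto simp: eval_poly_add)

lemma eval_poly_single [simp]: "eval_poly v (single m c) = c * eval_mon v m"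
  by (simp add: eval_poly_def)

lemma eval_poly_mult: "eval_poly v (p * q) = eval_poly v p * eval_poly v q"
proof -
  have "p * q = (\<Sum>m\<in>keys p. \<Sum>n\<in>keys q. single m (lookup p m) * single n (lookup q n))"
    by (simp only: sum_product[symmetric] sum_single_lookup)
  then have "eval_poly v (p * q)
      = (\<Sum>m\<in>keys p. \<Sum>n\<in>keys q. (lookup p m * eval_mon v m) * (lookup q n * eval_mon v n))"
    by (simp add: eval_poly_sum mult_single eval_mon_add mult_ac)
  then show ?thesis
    by (simp only: eval_poly_def sum_product)
qed

lemma eval_poly_smul: "eval_poly v (smul c p) = c * eval_poly v p"
  by (simp add: smul_def eval_poly_mult) (simp add: eval_mon_def)

lemma eval_poly_var: "eval_poly v (var i) = v i"
  by (simp add: var_def eval_mon_def)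

lemma linear_form_on_eval_poly: "mp.linear_form_on S (eval_poly v)"
  by (simp add: mp.linear_form_on_def eval_poly_add eval_poly_smul)

section \<open>Quotients by ideals\<close>

lemma ideal_props:
  assumes "ideal I (mpoly_ring r)"
  shows "0 \<in> I" "p \<in> I \<Longrightarrow> p \<in> polys r" "p \<in> I \<Longrightarrow> q \<in> I \<Longrightarrow> p + q \<in> I"
    "p \<in> I \<Longrightarrow> q \<in> polys r \<Longrightarrow> q * p \<in> I"
  using additive_subgroup.zero_closed[OF ideal.axioms(1)[OF assms]]
    additive_subgroup.a_Hcarr[OF ideal.axioms(1)[OF assms]]
    additive_subgroup.a_closed[OF ideal.axioms(1)[OF assms]]
    ideal.I_l_closed[OF assms] by simp_all

lemma subspace_ideal: "ideal I (mpoly_ring r) \<Longrightarrow> mp.subspace I"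
  by (rule mp.subspaceI) (auto simp: smul_def polys_single intro: ideal_props)

lemma coset_eq_iff:
  assumes I: "ideal I (mpoly_ring r)"
  shows "I +>\<^bsub>mpoly_ring r\<^esub> p = I +>\<^bsub>mpoly_ring r\<^esub> q \<longleftrightarrow> p - q \<in> I"
proof -
  have coset: "I +>\<^bsub>mpoly_ring r\<^esub> p = (\<lambda>h. h + p) ` I" for p
    by (auto simp: a_r_coset_def')
  note sub = subspace_ideal[OF I]
  show ?thesis unfolding coset
  proof
    assume "(\<lambda>h. h + p) ` I = (\<lambda>h. h + q) ` I"
    then have "0 + p \<in> (\<lambda>h. h + q) ` I" using ideal_props(1)[OF I] by blast
    then show "p - q \<in> I" by auto
  next
    assume pq: "p - q \<in> I"
    have "h + p = (h + (p - q)) + q" "h + q = (h - (p - q)) + p" for h by simp_all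
    then show "(\<lambda>h. h + p) ` I = (\<lambda>h. h + q) ` I"
      using mp.subspace_add[OF sub _ pq] mp.subspace_diff[OF sub _ pq]
      by (intro equalityI image_subsetI) (metis imageI)+
  qed
qed

lemma carrier_quot: "carrier (quot_alg r I) = image_in_quot r I (polys r)"
  by (auto simp: FactRing_def A_RCOSETS_def')

lemma coset_zero_iff:
  assumes I: "ideal I (mpoly_ring r)"
  shows "I +>\<^bsub>mpoly_ring r\<^esub> p = \<zero>\<^bsub>quot_alg r I\<^esub> \<longleftrightarrow> p \<in> I"
proof -
  have "\<zero>\<^bsub>quot_alg r I\<^esub> = I +>\<^bsub>mpoly_ring r\<^esub> 0"
    by (auto simp: FactRing_def a_r_coset_def')
  then show ?thesis using coset_eq_iff[OF I, of p 0] by simp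
qed

lemma coset_add_mult:
  assumes "ideal I (mpoly_ring r)" "p \<in> polys r" "q \<in> polys r"
  shows "(I +>\<^bsub>mpoly_ring r\<^esub> p) \<oplus>\<^bsub>quot_alg r I\<^esub> (I +>\<^bsub>mpoly_ring r\<^esub> q) = I +>\<^bsub>mpoly_ring r\<^esub> (p + q)"
    "(I +>\<^bsub>mpoly_ring r\<^esub> p) \<otimes>\<^bsub>quot_alg r I\<^esub> (I +>\<^bsub>mpoly_ring r\<^esub> q) = I +>\<^bsub>mpoly_ring r\<^esub> (p * q)"
  using ring_hom_add[OF ideal.rcos_ring_hom[OF assms(1)], of p q]
    ring_hom_mult[OF ideal.rcos_ring_hom[OF assms(1)], of p q] assms(2,3) by simp_all

section \<open>Dimension of the image of a subspace\<close>

lemma line_extension_quot: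
  assumes I: "ideal I (mpoly_ring r)" and v: "v \<in> polys r" and s: "range s \<subseteq> polys r"
  shows "ring.line_extension (quot_alg r I) (quot_scalars r I) (I +>\<^bsub>mpoly_ring r\<^esub> v)
      (image_in_quot r I (range s)) = image_in_quot r I (range (\<lambda>(c, k). smul c v + s k))"
proof -
  interpret A: ring "quot_alg r I" by (rule ideal.quotient_is_ring[OF I])
  have "(I +>\<^bsub>mpoly_ring r\<^esub> single 0 c) \<otimes>\<^bsub>quot_alg r I\<^esub> (I +>\<^bsub>mpoly_ring r\<^esub> v)
      \<oplus>\<^bsub>quot_alg r I\<^esub> (I +>\<^bsub>mpoly_ring r\<^esub> s k) = I +>\<^bsub>mpoly_ring r\<^esub> (smul c v + s k)" for c k
    using s v by (simp add: coset_add_mult[OF I] polys_single polys_mult smul_def image_subset_iff)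
  then show ?thesis
    by (intro equalityI subsetI) (auto simp: A.line_extension_mem_iff quot_scalars_def image_iff)
qed

text \<open>The library builds \<open>dimension\<close> by successive line extensions. A
  representative for each added vector turns this into a basis of polynomials modulo
  \<open>I\<close>; both directions are inductions that add one vector.\<close>

lemma dimension_quot_iff:
  assumes I: "ideal I (mpoly_ring r)"
  shows "has_k_dim r I E n \<longleftrightarrow> (\<exists>e. (\<forall>i<n. e i \<in> polys r) \<and>
      (\<forall>c. (\<Sum>i<n. smul (c i) (e i)) \<in> I \<longrightarrow> (\<forall>i<n. c i = 0)) \<and>
      E = image_in_quot r I (range (\<lambda>c. \<Sum>i<n. smul (c i) (e i))))" (is "_ \<longleftrightarrow> (\<exists>e. ?basis e n E)")
proof -
  interpret A: ring "quot_alg r I" by (rule ideal.quotient_is_ring[OF I])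
  note sub = subspace_ideal[OF I]
  define span where "span e n = range (\<lambda>c. \<Sum>i<n. smul (c i) (e i))" for e :: "nat \<Rightarrow> 'a mpoly" and n :: nat
  have span_polys: "span e n \<subseteq> polys r" if "\<forall>i<n. e i \<in> polys r" for e n
    unfolding span_def using that
    by (intro image_subsetI mp.subspace_sum[OF subspace_polys] mp.subspace_scale[OF subspace_polys]) auto
  have span_Suc: "range (\<lambda>(c, k). smul c (e n) + (\<Sum>i<n. smul (k i) (e i))) = span e (Suc n)" for e n
  proof (intro equalityI subsetI)
    fix p assume "p \<in> range (\<lambda>(c, k). smul c (e n) + (\<Sum>i<n. smul (k i) (e i)))"
    then obtain c k where p: "p = smul c (e n) + (\<Sum>i<n. smul (k i) (e i))" by auto
    then have "p = (\<Sum>i<Suc n. smul ((k(n := c)) i) (e i))" by (simp add: add.commute)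
    then show "p \<in> span e (Suc n)" unfolding span_def by blast
  next
    fix p assume "p \<in> span e (Suc n)"
    then obtain k where "p = (\<Sum>i<Suc n. smul (k i) (e i))" by (auto simp: span_def)
    then have "p = (\<lambda>(c, k). smul c (e n) + (\<Sum>i<n. smul (k i) (e i))) (k n, k)"
      by (simp add: add.commute)
    then show "p \<in> range (\<lambda>(c, k). smul c (e n) + (\<Sum>i<n. smul (k i) (e i)))" by blast
  qed
  have extend: "A.line_extension (quot_scalars r I) (I +>\<^bsub>mpoly_ring r\<^esub> e n) (image_in_quot r I (span e n))
      = image_in_quot r I (span e (Suc n))" if "\<forall>i<Suc n. e i \<in> polys r" for e n
    using line_extension_quot[OF I, of "e n" "\<lambda>c. \<Sum>i<n. smul (c i) (e i)"] that
      span_polys[of n e] by (simp add: span_Suc) (simp add: span_def)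
  \<comment> \<open>\<open>K\<close> is kept as a variable so that rule induction applies; the
    equation fixes it again.\<close>
  have basis_if_dim: "\<exists>e. ?basis e n E" if "A.dimension n K E" "K = quot_scalars r I" for K
    using that
  proof (induction rule: A.dimension.induct)
    case zero_dim
    have "\<zero>\<^bsub>quot_alg r I\<^esub> = I +>\<^bsub>mpoly_ring r\<^esub> 0"
      using coset_zero_iff[OF I, of 0] ideal_props(1)[OF I] by simp
    then show ?case by auto
  next
    case (Suc_dim v E n K)
    then obtain e where e: "?basis e n E" by blast
    obtain w where w: "w \<in> polys r" "v = I +>\<^bsub>mpoly_ring r\<^esub> w"
      using Suc_dim(1) by (auto simp: carrier_quot)
    define e' where "e' = e(n := w)"
    have span_e': "span e' n = span e n"
      by (auto simp: span_def e'_def)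
    have polys: "\<forall>i<Suc n. e' i \<in> polys r"
      using e w(1) by (auto simp: e'_def less_Suc_eq)
    \<comment> \<open>A nonzero last coefficient could be divided out, which would place
      \<open>v\<close> in \<open>E\<close>, although a line extension adds a vector outside
      \<open>E\<close>.\<close>
    have last: "c n = 0" if "(\<Sum>i<Suc n. smul (c i) (e' i)) \<in> I" for c
    proof (rule ccontr)
      assume c: "c n \<noteq> 0"
      define u where "u = (\<Sum>i<n. smul (- inverse (c n) * c i) (e i))"
      have "smul (inverse (c n)) (\<Sum>i<Suc n. smul (c i) (e' i))
          = (\<Sum>i<n. smul (inverse (c n) * c i) (e i)) + w"
        using c by (simp add: e'_def mp.scale_right_distrib mp.scale_sum_right)
      then have "smul (inverse (c n)) (\<Sum>i<Suc n. smul (c i) (e' i)) = w - u"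
        unfolding u_def by (simp add: sum_negf)
      then have "w - u \<in> I" using mp.subspace_scale[OF sub that] by metis
      then have "v = I +>\<^bsub>mpoly_ring r\<^esub> u" using w(2) by (simp add: coset_eq_iff[OF I])
      moreover have "I +>\<^bsub>mpoly_ring r\<^esub> u \<in> E"
        unfolding conjunct2[OF conjunct2[OF e]] u_def
        by (intro imageI rangeI[of "\<lambda>c. \<Sum>i<n. smul (c i) (e i)"])
      ultimately show False using Suc_dim(2) by simp
    qed
    have ind: "\<forall>c. (\<Sum>i<Suc n. smul (c i) (e' i)) \<in> I \<longrightarrow> (\<forall>i<Suc n. c i = 0)"
    proof (intro allI impI)
      fix c i assume c: "(\<Sum>i<Suc n. smul (c i) (e' i)) \<in> I" and i: "i < Suc n"
      have "(\<Sum>i<n. smul (c i) (e i)) \<in> I"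
        using c last[OF c] by (simp add: e'_def)
      then have "\<forall>i<n. c i = 0" using e by simp
      then show "c i = 0" using last[OF c] i by (auto simp: less_Suc_eq)
    qed
    have "E = image_in_quot r I (span e' n)"
      unfolding span_e' unfolding span_def by (rule conjunct2[OF conjunct2[OF e]])
    moreover have "v = I +>\<^bsub>mpoly_ring r\<^esub> e' n"
      by (simp add: e'_def w(2))
    ultimately have "A.line_extension (quot_scalars r I) v E = image_in_quot r I (span e' (Suc n))"
      using extend[OF polys] by (simp only:)
    then show ?case
      unfolding span_def Suc_dim.prems by (intro exI[of _ e'] conjI polys ind)
  qed
  have dim_if_basis: "A.dimension n (quot_scalars r I) E" if "?basis e n E" for e
    using that
  proof (induction n arbitrary: E)
    case 0
    then show ?case
      using A.dimension.zero_dim coset_zero_iff[OF I, of 0] ideal_props(1)[OF I] by simp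
  next
    case (Suc n)
    have ind: "c i = 0" if "(\<Sum>i<Suc n. smul (c i) (e i)) \<in> I" "i < Suc n" for c i
      using that by (rule conjunct1[OF conjunct2[OF Suc.prems], rule_format])
    have "\<forall>i<n. c i = 0" if "(\<Sum>i<n. smul (c i) (e i)) \<in> I" for c
    proof -
      have "(\<Sum>i<Suc n. smul ((c(n := 0)) i) (e i)) \<in> I" using that by simp
      then have zero: "(c(n := 0)) i = 0" if "i < Suc n" for i
        using ind that by blast
      show ?thesis
      proof (intro allI impI)
        fix i assume "i < n"
        then show "c i = 0" using zero[of i] by simp
      qed
    qed
    then have dim: "A.dimension n (quot_scalars r I) (image_in_quot r I (span e n))"
      using Suc.prems by (intro Suc.IH) (simp add: span_def)
    have new: "I +>\<^bsub>mpoly_ring r\<^esub> e n \<notin> image_in_quot r I (span e n)"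
    proof
      assume "I +>\<^bsub>mpoly_ring r\<^esub> e n \<in> image_in_quot r I (span e n)"
      then obtain k where "e n - (\<Sum>i<n. smul (k i) (e i)) \<in> I"
        by (auto simp: span_def coset_eq_iff[OF I])
      \<comment> \<open>Membership in the old span is a relation whose last coefficient is
        1.\<close>
      then have "(\<Sum>i<Suc n. smul (((\<lambda>i. - k i)(n := 1)) i) (e i)) \<in> I"
        by (simp add: sum_negf)
      then have "((\<lambda>i. - k i)(n := 1)) n = 0"
        by (rule ind) simp
      then show False by simp
    qed
    have "I +>\<^bsub>mpoly_ring r\<^esub> e n \<in> carrier (quot_alg r I)"
      using Suc.prems by (simp add: carrier_quot)
    from A.dimension.Suc_dim[OF this new dim]
    show ?case
      unfolding extend[OF conjunct1[OF Suc.prems]] conjunct2[OF conjunct2[OF Suc.prems]]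
      by (simp only: span_def)
  qed
  show ?thesis unfolding has_k_dim_def
    by (rule iffI, erule basis_if_dim[OF _ refl], erule exE, erule dim_if_basis)
qed

lemma has_k_dim_image:
  assumes I: "ideal I (mpoly_ring r)" and S: "mp.subspace S" "S \<subseteq> polys r"
  shows "has_k_dim r I (image_in_quot r I S) n \<longleftrightarrow> mp.quotient_dim S I n"
proof
  note sub = subspace_ideal[OF I]
  assume "has_k_dim r I (image_in_quot r I S) n"
  then obtain e where e: "\<forall>i<n. e i \<in> polys r"
    "\<forall>c. (\<Sum>i<n. smul (c i) (e i)) \<in> I \<longrightarrow> (\<forall>i<n. c i = 0)"
    "image_in_quot r I S = image_in_quot r I (range (\<lambda>c. \<Sum>i<n. smul (c i) (e i)))"
    unfolding dimension_quot_iff[OF I] by (elim exE conjE)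
  \<comment> \<open>The basis vectors need not lie in \<open>S\<close>, only their cosets come from
    \<open>S\<close>; congruent elements of \<open>S\<close> replace them.\<close>
  have "\<exists>s\<in>S. e i - s \<in> I" if "i < n" for i
  proof -
    have "(\<Sum>j<n. smul (if j = i then 1 else 0) (e j)) = (\<Sum>j<n. if j = i then e j else 0)"
      by (rule sum.cong) auto
    then have "(\<Sum>j<n. smul (if j = i then 1 else 0) (e j)) = e i"
      using that by simp
    then have "e i \<in> range (\<lambda>c. \<Sum>i<n. smul (c i) (e i))"
      by (intro range_eqI[of _ _ "\<lambda>j. if j = i then 1 else 0"]) simp
    then have "I +>\<^bsub>mpoly_ring r\<^esub> e i \<in> image_in_quot r I (range (\<lambda>c. \<Sum>i<n. smul (c i) (e i)))"
      by (rule imageI)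
    then show ?thesis
      unfolding e(3)[symmetric] by (auto simp: coset_eq_iff[OF I])
  qed
  then obtain s where s: "\<And>i. i < n \<Longrightarrow> s i \<in> S" "\<And>i. i < n \<Longrightarrow> e i - s i \<in> I" by metis
  have diff: "(\<Sum>i<n. smul (c i) (e i)) - (\<Sum>i<n. smul (c i) (s i)) \<in> I" for c
  proof -
    have "(\<Sum>i<n. smul (c i) (e i - s i)) \<in> I"
      using s(2) by (intro mp.subspace_sum[OF sub] mp.subspace_scale[OF sub]) auto
    then show ?thesis by (simp add: mp.scale_right_diff_distrib sum_subtractf)
  qed
  show "mp.quotient_dim S I n" unfolding mp.quotient_dim_def mp.basis_modulo_def
  proof (intro exI[of _ s] conjI allI impI ballI)
    fix c i assume "(\<Sum>i<n. smul (c i) (s i)) \<in> I" "i < n"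
    from mp.subspace_add[OF sub diff[of c] this(1)]
    have "(\<Sum>i<n. smul (c i) (e i)) \<in> I" by simp
    then show "c i = 0" using e(2) \<open>i < n\<close> by blast
  next
    fix p assume "p \<in> S"
    then have "I +>\<^bsub>mpoly_ring r\<^esub> p \<in> image_in_quot r I (range (\<lambda>c. \<Sum>i<n. smul (c i) (e i)))"
      unfolding e(3)[symmetric] by blast
    then obtain c where "p - (\<Sum>i<n. smul (c i) (e i)) \<in> I"
      by (auto simp: coset_eq_iff[OF I])
    from mp.subspace_add[OF sub this diff[of c]]
    show "\<exists>c. p - (\<Sum>i<n. smul (c i) (s i)) \<in> I" by auto
  qed (use s in auto)
next
  assume "mp.quotient_dim S I n"
  then obtain e where "mp.basis_modulo S I n e" by (rule mp.quotient_dimE)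
  note e = mp.basis_moduloD[OF this]
  have sum: "(\<Sum>i<n. smul (c i) (e i)) \<in> S" for c
    using e(1) by (intro mp.subspace_sum[OF S(1)] mp.subspace_scale[OF S(1)]) auto
  have image: "image_in_quot r I S = image_in_quot r I (range (\<lambda>c. \<Sum>i<n. smul (c i) (e i)))"
  proof (intro equalityI image_subsetI)
    fix p assume "p \<in> S"
    then obtain c where "p - (\<Sum>i<n. smul (c i) (e i)) \<in> I" using e(3) by blast
    then have "I +>\<^bsub>mpoly_ring r\<^esub> p = I +>\<^bsub>mpoly_ring r\<^esub> (\<Sum>i<n. smul (c i) (e i))"
      by (simp add: coset_eq_iff[OF I])
    then show "I +>\<^bsub>mpoly_ring r\<^esub> p \<in> image_in_quot r I (range (\<lambda>c. \<Sum>i<n. smul (c i) (e i)))"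
      by simp
  qed (use sum in auto)
  show "has_k_dim r I (image_in_quot r I S) n"
    unfolding dimension_quot_iff[OF I]
  proof (intro exI[of _ e] conjI allI impI image)
    fix i assume "i < n"
    then show "e i \<in> polys r" using e(1) S(2) by blast
  next
    fix c i assume "(\<Sum>i<n. smul (c i) (e i)) \<in> I" "i < n"
    then show "c i = 0" by (rule e(2))
  qed
qed

lemma has_k_dim_quot_component:
  assumes "ideal I (mpoly_ring r)"
  shows "has_k_dim r I (quot_component r I d) n \<longleftrightarrow> mp.quotient_dim (forms r d) I n"
  unfolding quot_component_def
  by (rule has_k_dim_image[OF assms subspace_forms]) (auto simp: forms_polys)

section \<open>Socle and chain condition of the quotient\<close>

lemma mem_socle_iff:
  assumes I: "ideal I (mpoly_ring r)" and p: "p \<in> polys r"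
  shows "I +>\<^bsub>mpoly_ring r\<^esub> p \<in> socle r I \<longleftrightarrow>
    (\<forall>q\<in>polys r. lookup q 0 = 0 \<longrightarrow> p * q \<in> I)"
proof -
  have "I +>\<^bsub>mpoly_ring r\<^esub> p \<in> socle r I \<longleftrightarrow> (\<forall>q\<in>polys r. lookup q 0 = 0 \<longrightarrow>
      (I +>\<^bsub>mpoly_ring r\<^esub> p) \<otimes>\<^bsub>quot_alg r I\<^esub> (I +>\<^bsub>mpoly_ring r\<^esub> q) = \<zero>\<^bsub>quot_alg r I\<^esub>)"
    using p by (auto simp: socle_def hom_max_ideal_def carrier_quot)
  then show ?thesis
    using coset_add_mult(2)[OF I p] coset_zero_iff[OF I] by auto
qed

text \<open>Every monomial of a polynomial without constant term is a multiple of a variable, so the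
  variables alone test membership in the socle.\<close>

lemma var_multiples_imp_mem_socle:
  assumes I: "ideal I (mpoly_ring r)" and p: "p \<in> polys r"
    and var: "\<And>i. i < r \<Longrightarrow> var i * p \<in> I"
  shows "I +>\<^bsub>mpoly_ring r\<^esub> p \<in> socle r I"
  unfolding mem_socle_iff[OF I p]
proof (intro ballI impI)
  fix q :: "'a mpoly" assume q: "q \<in> polys r" "lookup q 0 = 0"
  have "p * single m (lookup q m) \<in> I" if m: "m \<in> keys q" for m
  proof -
    have "m \<noteq> 0" using q(2) m by (auto simp: in_keys_iff)
    then obtain i n where i: "i \<in> keys m" "m = single i 1 + n" "keys n \<subseteq> keys m"
      by (rule exponent_split)
    have "single m (lookup q m) = single n (lookup q m) * var i"
      using i(2) by (simp add: var_def mult_single add.commute)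
    then have "p * single m (lookup q m) = single n (lookup q m) * (var i * p)"
      by (simp add: mult_ac)
    moreover have "single n (lookup q m) \<in> polys r" "i < r"
      using i m q(1) by (auto simp: polys_single polys_iff)
    ultimately show ?thesis using ideal_props(4)[OF I var] by metis
  qed
  then have "(\<Sum>m\<in>keys q. p * single m (lookup q m)) \<in> I"
    by (intro mp.subspace_sum[OF subspace_ideal[OF I]])
  then show "p * q \<in> I"
    by (simp add: sum_distrib_left[symmetric] sum_single_lookup)
qed

text \<open>The preimages of the ideals \<open>J n\<close> are subspaces between \<open>I\<close>
  and the polynomial ring, where \<open>I\<close> has finite codimension, so the chain
  stabilizes.\<close>

lemma artinian_quot:
  assumes I: "ideal I (mpoly_ring r)" and Y: "finite Y"
    and span: "\<And>p. p \<in> polys r \<Longrightarrow> \<exists>c. p - (\<Sum>y\<in>Y. smul (c y) (e y)) \<in> I"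
  shows "artinian_ring (quot_alg r I)"
  unfolding artinian_ring_def
proof (intro conjI allI impI)
  show "cring (quot_alg r I)"
    by (rule ideal.quotient_is_cring[OF I cring_mpoly_ring])
next
  fix J assume "(\<forall>n. ideal (J n) (quot_alg r I)) \<and> (\<forall>n. J (Suc n) \<subseteq> J n)"
  then have J: "\<forall>n. ideal (J n) (quot_alg r I)" and dec: "\<forall>n. J (Suc n) \<subseteq> J n" by auto
  define P where "P n = {p \<in> polys r. I +>\<^bsub>mpoly_ring r\<^esub> p \<in> J n}" for n :: nat
  have J_eq: "J n = image_in_quot r I (P n)" for n
    using ideal.Icarr[OF spec[OF J]] unfolding P_def by (fastforce simp: carrier_quot)
  have zero: "I +>\<^bsub>mpoly_ring r\<^esub> p \<in> J n" if "p \<in> I" for p n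
    using additive_subgroup.zero_closed[OF ideal.axioms(1)[OF spec[OF J, of n]]]
      coset_zero_iff[OF I, of p] that by simp
  have "mp.subspace (P n)" for n
  proof (rule mp.subspaceI)
    show "0 \<in> P n" using zero[OF ideal_props(1)[OF I]] by (simp add: P_def)
  next
    fix p q assume "p \<in> P n" "q \<in> P n"
    then show "p + q \<in> P n"
      using additive_subgroup.a_closed[OF ideal.axioms(1)[OF spec[OF J, of n]]]
      by (auto simp: P_def polys_add coset_add_mult(1)[OF I, symmetric])
  next
    fix c p assume "p \<in> P n"
    then show "smul c p \<in> P n"
      using ideal.I_l_closed[OF spec[OF J, of n]]
      by (auto simp: P_def smul_def polys_mult polys_single carrier_quot coset_add_mult(2)[OF I, symmetric])
  qed
  moreover have "P (Suc n) \<subseteq> P n" "P n \<subseteq> polys r" "I \<subseteq> P n" for n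
    using dec zero ideal_props(2)[OF I] by (auto simp: P_def)
  ultimately have "\<exists>n. \<forall>m\<ge>n. P m = P n"
    by (intro mp.descending_chain_stabilizes[OF _ _ _ subspace_ideal[OF I] _ Y span])
  then show "\<exists>N. \<forall>n\<ge>N. J n = J N"
    unfolding J_eq by metis
qed

text \<open>The index map \<open>g\<close> gives one argument for variables and for products of two
  variables; injectivity keeps a monomial from being counted twice.\<close>

lemma expand_in_monomials:
  assumes X: "finite X" "inj_on g X" and keys: "\<And>m. m \<in> keys p \<Longrightarrow> m \<in> g ` X"
  shows "p = (\<Sum>x\<in>X. smul (lookup p (g x)) (single (g x) 1))"
proof -
  have "p = (\<Sum>m\<in>keys p. single m (lookup p m))" by (rule sum_single_lookup[symmetric])
  also have "\<dots> = (\<Sum>m\<in>g ` X. single m (lookup p m))"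
    using X(1) keys by (intro sum.mono_neutral_left) (auto simp: in_keys_iff)
  also have "\<dots> = (\<Sum>x\<in>X. single (g x) (lookup p (g x)))"
    using X(2) by (simp add: sum.reindex)
  finally show ?thesis by (simp add: smul_single)
qed

text \<open>Each exponent is at most the degree, so the exponent maps are functions from
  \<open>{..<r}\<close> into \<open>{..s}\<close>, extended by zero.\<close>

lemma finite_exponents: "finite {m. keys m \<subseteq> {..<r} \<and> mon_degree m \<le> s}" (is "finite ?E")
proof (rule finite_imageD)
  have le: "lookup m i \<le> mon_degree m" for m i
  proof (cases "i \<in> keys m")
    case True
    then show ?thesis unfolding mon_degree_def by (rule member_le_sum) auto
  qed (simp add: not_in_keys_iff_lookup_eq_zero)
  have "lookup ` ?E \<subseteq> {f. \<forall>i. (i \<in> {..<r} \<longrightarrow> f i \<in> {..s}) \<and> (i \<notin> {..<r} \<longrightarrow> f i = 0)}"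
  proof (rule image_subsetI, intro CollectI allI conjI impI)
    fix m i assume m: "m \<in> ?E"
    show "lookup m i \<in> {..s}" using m le[of m i] by simp
    assume "i \<notin> {..<r}"
    then have "i \<notin> keys m" using m by blast
    then show "lookup m i = 0" by (simp add: not_in_keys_iff_lookup_eq_zero)
  qed
  then show "finite (lookup ` ?E)"
    by (rule finite_subset) (rule finite_set_of_finite_funs, auto)
  show "inj_on lookup ?E" by (rule inj_onI) (rule poly_mapping_eqI, rule fun_cong)
qed

section \<open>Macaulay's inverse system\<close>

text \<open>The largest ideal whose part of degree \<open>s\<close> is killed by the functionals \<open>\<phi> j\<close>, \<open>j < t\<close>.\<close>

definition macaulay_ideal :: "nat \<Rightarrow> nat \<Rightarrow> nat \<Rightarrow> (nat \<Rightarrow> 'k::field mpoly \<Rightarrow> 'k) \<Rightarrow> 'k mpoly set" where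
  "macaulay_ideal r s t \<phi> =
     {p \<in> polys r. \<forall>f\<in>polys r. \<forall>j<t. \<phi> j (hom_component s (f * p)) = 0}"

locale inverse_system =
  fixes r s t :: nat and \<phi> :: "nat \<Rightarrow> 'k::field mpoly \<Rightarrow> 'k"
  assumes linear: "\<And>j. j < t \<Longrightarrow> mp.linear_form_on (forms r s) (\<phi> j)"
begin

abbreviation "M \<equiv> macaulay_ideal r s t \<phi>"

lemma \<phi>_zero: "j < t \<Longrightarrow> \<phi> j 0 = 0"
  using mp.linear_form_onD(2)[OF linear mp.subspace_0[OF subspace_forms], of j 0] by simp

lemma M_D: "p \<in> M \<Longrightarrow> f \<in> polys r \<Longrightarrow> j < t \<Longrightarrow> \<phi> j (hom_component s (f * p)) = 0"
  by (simp add: macaulay_ideal_def)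

text \<open>Products stay in \<open>M\<close> because the multiplier \<open>f\<close> ranges over
  all polynomials, so that \<open>f * q\<close> is again a multiplier.\<close>

lemma ideal_M: "ideal M (mpoly_ring r)"
proof -
  have add: "p + q \<in> M" if "p \<in> M" "q \<in> M" for p q
  proof -
    have "\<phi> j (hom_component s (f * (p + q))) = 0" if f: "f \<in> polys r" and j: "j < t" for f j
    proof -
      have "hom_component s (f * p) \<in> forms r s" "hom_component s (f * q) \<in> forms r s"
        using \<open>p \<in> M\<close> \<open>q \<in> M\<close> f by (auto simp: macaulay_ideal_def intro: hom_component_forms polys_mult)
      from mp.linear_form_onD(1)[OF linear[OF j] this] show ?thesis
        using \<open>p \<in> M\<close> \<open>q \<in> M\<close> f j by (simp add: macaulay_ideal_def distrib_left hom_component_add)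
    qed
    then show ?thesis using that by (simp add: macaulay_ideal_def polys_add)
  qed
  have mult: "q * p \<in> M" if "p \<in> M" "q \<in> polys r" for p q
    using that polys_mult by (fastforce simp: macaulay_ideal_def mult.assoc[symmetric])
  have mult': "p * q \<in> M" if "p \<in> M" "q \<in> polys r" for p q
    unfolding mult.commute[of p q] by (rule mult[OF that])
  have zero: "0 \<in> M" by (simp add: macaulay_ideal_def \<phi>_zero)
  show ?thesis
  proof (rule idealI[OF ring_mpoly_ring])
    show "subgroup M (add_monoid (mpoly_ring r))"
    proof (rule subgroup.intro)
      fix p assume p: "p \<in> M"
      then have polys: "p \<in> polys r" by (simp add: macaulay_ideal_def)
      interpret cring "mpoly_ring r :: 'k mpoly ring" by (rule cring_mpoly_ring)
      have "inv\<^bsub>add_monoid (mpoly_ring r)\<^esub> p = - p"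
        using minus_equality[of "- p" p] polys polys_uminus[OF polys] by (simp add: a_inv_def)
      \<comment> \<open>Negatives come from closure under products with the constant -1.\<close>
      moreover have "single 0 (-1) * p \<in> M" by (rule mult[OF p]) (simp add: polys_single)
      moreover have "single 0 (-1) * p = - p"
        unfolding smul_def[symmetric] by (rule poly_mapping_eqI) simp
      ultimately show "inv\<^bsub>add_monoid (mpoly_ring r)\<^esub> p \<in> M" by simp
    qed (auto simp: add zero, simp add: macaulay_ideal_def)
  qed (auto simp: mult mult')
qed

text \<open>Against a form of degree \<open>d\<close>, only the part of the multiplier in degree
  \<open>s - d\<close> contributes to degree \<open>s\<close>.\<close>

lemma forms_mem_M_iff:
  assumes q: "q \<in> forms r d" and d: "d \<le> s"
  shows "q \<in> M \<longleftrightarrow> (\<forall>f\<in>forms r (s - d). \<forall>j<t. \<phi> j (f * q) = 0)"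
proof -
  have eq: "hom_component s (f * q) = hom_component (s - d) f * q" for f
    using hom_component_mult_form[OF q, of s f] d by simp
  show ?thesis
    using q forms_polys[OF q] unfolding macaulay_ideal_def mem_Collect_eq eq
    by (metis forms_iff forms_polys hom_component_forms)
qed

text \<open>Multiples of a form of degree above \<open>s\<close> have no part in degree
  \<open>s\<close>.\<close>

lemma forms_subset_M:
  assumes q: "q \<in> forms r d" and d: "s < d"
  shows "q \<in> M"
  using forms_polys[OF q] d by (simp add: macaulay_ideal_def hom_component_mult_form[OF q] \<phi>_zero)

text \<open>For a multiplier \<open>f\<close> of degree \<open>s - d\<close>, the part of
  \<open>f * p\<close> in degree \<open>s\<close> only sees the part of \<open>p\<close> in degree
  \<open>d\<close>, so testing the component is a special case of testing \<open>p\<close>.\<close>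

lemma homogeneous_M: "homogeneous_ideal r M"
  unfolding homogeneous_ideal_def
proof (intro conjI ideal_M ballI allI)
  fix p d assume p: "p \<in> M"
  then have polys: "p \<in> polys r" by (simp add: macaulay_ideal_def)
  note pd = hom_component_forms[OF polys, of d]
  show "hom_component d p \<in> M"
  proof (cases "d \<le> s")
    case True
    have "\<phi> j (f * hom_component d p) = 0" if f: "f \<in> forms r (s - d)" and "j < t" for f j
    proof -
      have "f * hom_component d p = hom_component s (f * p)"
        using hom_component_mult_form[OF f, of s p] True by (simp add: mult.commute)
      then show ?thesis using p that forms_polys[OF f] by (simp add: macaulay_ideal_def)
    qed
    then show ?thesis using forms_mem_M_iff[OF pd True] by blast
  qed (use forms_subset_M[OF pd] in simp)
qed

text \<open>Monomials of degree above \<open>s\<close> lie in \<open>M\<close>; the finitely many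
  others span the quotient.\<close>

lemma artinian_M: "artinian_ring (quot_alg r M)"
proof (rule artinian_quot[OF ideal_M finite_exponents])
  fix p :: "'k mpoly" assume p: "p \<in> polys r"
  let ?E = "{m. keys m \<subseteq> {..<r} \<and> mon_degree m \<le> s}"
  let ?sum = "\<Sum>m\<in>?E. smul (lookup p m) (single m 1)"
  define q where "q = p - ?sum"
  have "lookup ?sum k = (\<Sum>m\<in>?E. if m = k then lookup p m else 0)" for k
    by (auto simp: lookup_sum lookup_single when_def intro!: sum.cong)
  then have lookup_q: "lookup q k = (if k \<in> ?E then 0 else lookup p k)" for k
    by (simp add: q_def lookup_minus finite_exponents)
  have "single m (lookup q m) \<in> M" if "m \<in> keys q" for m
  proof (rule forms_subset_M)
    show "single m (lookup q m) \<in> forms r (mon_degree m)"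
      using p that lookup_q by (intro formsI) (auto simp: polys_single polys_iff in_keys_iff split: if_splits)
    have "m \<notin> ?E" "m \<in> keys p"
      using that lookup_q[of m] by (auto simp: in_keys_iff split: if_splits)
    then show "s < mon_degree m" using p unfolding polys_iff by auto
  qed
  then have "(\<Sum>m\<in>keys q. single m (lookup q m)) \<in> M"
    by (intro mp.subspace_sum[OF subspace_ideal[OF ideal_M]])
  then show "\<exists>c. p - (\<Sum>m\<in>?E. smul (c m) (single m 1)) \<in> M"
    unfolding sum_single_lookup q_def by (rule exI[of _ "lookup p"])
qed

text \<open>Levelness is automatic for \<open>M\<close>. A socle element agrees modulo
  \<open>M\<close> with its part of degree \<open>s\<close>, as the functionals cannot see the
  difference; conversely, a form of degree \<open>s\<close> times a polynomial without constant term
  has no part in degree \<open>s\<close>.\<close>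

lemma socle_M: "socle r M = quot_component r M s"
proof (intro equalityI subsetI)
  fix a assume a: "a \<in> socle r M"
  then obtain p where p: "p \<in> polys r" "a = M +>\<^bsub>mpoly_ring r\<^esub> p"
    by (auto simp: socle_def carrier_quot)
  have annih: "p * q \<in> M" if "q \<in> polys r" "lookup q 0 = 0" for q
    using a that unfolding p(2) mem_socle_iff[OF ideal_M p(1)] by blast
  define p' where "p' = hom_component s p"
  have p': "p' \<in> forms r s" unfolding p'_def by (rule hom_component_forms[OF p(1)])
  have "\<phi> j (hom_component s (f * (p - p'))) = 0" if f: "f \<in> polys r" and j: "j < t" for f j
  proof -
    \<comment> \<open>The multiplier is split into its constant term, for which
      \<open>p - p'\<close> contributes nothing in degree \<open>s\<close>, and a remainder that the
      socle condition controls.\<close>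
    define f' where "f' = f - smul (lookup f 0) 1"
    have f': "f' \<in> polys r"
      unfolding f'_def by (intro mp.subspace_diff[OF subspace_polys] f mp.subspace_scale[OF subspace_polys]) simp
    have f'0: "lookup f' 0 = 0" by (simp add: f'_def lookup_minus)
    have "hom_component 0 f' = 0"
      using f'0 by (intro poly_mapping_eqI) (simp add: mon_degree_eq_0_iff)
    then have 1: "hom_component s (f' * p') = 0"
      by (simp add: hom_component_mult_form[OF p'])
    have 2: "hom_component s (smul c (p - p')) = 0" for c
      using hom_component_form[OF p', of s] by (simp add: hom_component_smul hom_component_diff p'_def)
    have "f * (p - p') = f' * p - f' * p' + smul (lookup f 0) (p - p')"
      by (simp add: f'_def algebra_simps smul_mult_left smul_mult_right mp.scale_right_diff_distrib)
    then have "hom_component s (f * (p - p')) = hom_component s (f' * p)"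
      by (simp only: hom_component_add hom_component_diff 1 2) simp
    then show ?thesis
      using M_D[OF annih[OF f' f'0] polys_1 j] by (simp add: mult.commute[of p])
  qed
  then have "p - p' \<in> M"
    using p(1) forms_polys[OF p'] by (simp add: macaulay_ideal_def mp.subspace_diff[OF subspace_polys])
  then show "a \<in> quot_component r M s"
    using p' by (auto simp: p(2) coset_eq_iff[OF ideal_M] quot_component_def)
next
  fix a assume "a \<in> quot_component r M s"
  then obtain p where p: "p \<in> forms r s" "a = M +>\<^bsub>mpoly_ring r\<^esub> p"
    by (auto simp: quot_component_def)
  have "p * q \<in> M" if q: "q \<in> polys r" "lookup q 0 = 0" for q
  proof -
    have "hom_component s (f * (p * q)) = 0" for f
    proof -
      have "m + n \<noteq> 0" if "n \<in> keys q" for m n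
        using that q(2) by (metis add_eq_0_iff_both_eq_0 in_keys_iff mon_degree_add mon_degree_eq_0_iff)
      then have "lookup (f * q) 0 = 0"
        using keys_mult[of f q] by (auto simp: not_in_keys_iff_lookup_eq_zero[symmetric])
      then have "hom_component 0 (f * q) = 0"
        by (intro poly_mapping_eqI) (simp add: mon_degree_eq_0_iff)
      then show ?thesis
        using hom_component_mult_form[OF p(1), of s "f * q"] by (simp add: mult_ac)
    qed
    then show ?thesis
      using p(1) q by (simp add: macaulay_ideal_def \<phi>_zero forms_polys polys_mult)
  qed
  then show "a \<in> socle r M"
    unfolding p(2) mem_socle_iff[OF ideal_M forms_polys[OF p(1)]] by blast
qed

text \<open>Socle, homogeneity and the chain condition are already settled; what remains are
  numerical conditions and the absence of linear forms.\<close>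

lemma level_h_vector_M:
  assumes "length h = Suc s" "last h > 0" "M \<inter> forms r 1 = {0}"
    and dim: "\<And>i. i \<le> s \<Longrightarrow> mp.quotient_dim (forms r i) M (h ! i)"
  shows "level_h_vector TYPE('k) h"
proof -
  \<comment> \<open>Above degree \<open>s\<close> every form lies in \<open>M\<close>, and the empty
    family is a basis.\<close>
  have "mp.quotient_dim (forms r i) M 0" if "s < i" for i
    using forms_subset_M that unfolding mp.quotient_dim_def mp.basis_modulo_def by auto
  then have "has_h_vector r M h"
    using assms dim by (auto simp: has_h_vector_def has_k_dim_quot_component[OF ideal_M])
  moreover have "last h = h ! s" using assms(1) by (metis diff_Suc_1 last_conv_nth list.size(3) nat.distinct(1))
  then have "is_level r M h"
    using assms(1) dim[of s] by (simp add: is_level_def socle_M has_k_dim_quot_component[OF ideal_M])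
  moreover have "standard_graded_artinian r M"
    using homogeneous_M artinian_M assms(3) by (simp add: standard_graded_artinian_def)
  ultimately show ?thesis unfolding level_h_vector_def by blast
qed

end

section \<open>Level h-vectors of socle degree three\<close>

lemma single_1_eq_iff: "single i (1::nat) = single j 1 \<longleftrightarrow> i = j"
proof
  assume "single i (1::nat) = single j 1"
  then have "keys (single i (1::nat)) = keys (single j (1::nat))" by (rule arg_cong)
  then show "i = j" by simp
qed simp

lemma var_form_expand:
  assumes p: "p \<in> forms r 1"
  shows "p = (\<Sum>i<r. smul (lookup p (single i 1)) (var i))"
  unfolding var_def
proof (rule expand_in_monomials)
  show "inj_on (\<lambda>i. single i (1::nat)) {..<r}" by (rule inj_onI) (simp only: single_1_eq_iff)
  fix m assume m: "m \<in> keys p"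
  then have deg: "mon_degree m = 1" and vars: "keys m \<subseteq> {..<r}"
    using p by (auto simp: forms_def polys_iff)
  then have "m \<noteq> 0" by auto
  then obtain i n where n: "i \<in> keys m" "m = single i 1 + n" "mon_degree m = Suc (mon_degree n)"
    by (rule exponent_split)
  then have "n = 0" using deg mon_degree_eq_0_iff by simp
  then show "m \<in> (\<lambda>i. single i 1) ` {..<r}" using n vars by auto
qed simp

text \<open>One index pair per quadratic monomial, larger index first and squares included.\<close>

definition pairs :: "nat \<Rightarrow> (nat \<times> nat) set" where
  "pairs r = (SIGMA j:{..<r}. {..j})"

lemma finite_pairs: "finite (pairs r)"
  by (simp add: pairs_def)

lemma card_pairs: "card (pairs r) = (r + 1) choose 2"
proof -
  have "(\<Sum>j<r. Suc j) = (r + 1) choose 2"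
    by (induction r) (simp_all add: numeral_2_eq_2)
  then show ?thesis by (simp add: pairs_def card_SigmaI)
qed

lemma quadratic_form_expand:
  assumes p: "p \<in> forms r 2"
  shows "p = (\<Sum>(j, i)\<in>pairs r. smul (lookup p (single j 1 + single i 1)) (var j * var i))"
proof -
  define g :: "nat \<times> nat \<Rightarrow> nat \<Rightarrow>\<^sub>0 nat" where "g = (\<lambda>(j, i). single j 1 + single i 1)"
  have keys_g: "keys (g (j, i)) = {j, i}" for j i
    by (auto simp: g_def keys_add_exponent)
  have "p = (\<Sum>x\<in>pairs r. smul (lookup p (g x)) (single (g x) 1))"
  proof (rule expand_in_monomials[OF finite_pairs])
    show "inj_on g (pairs r)"
    proof (rule inj_onI, clarify)
      fix j i j' i' assume "(j, i) \<in> pairs r" "(j', i') \<in> pairs r" "g (j, i) = g (j', i')"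
      \<comment> \<open>The support recovers the unordered pair, and \<open>i \<le> j\<close>
        recovers the order.\<close>
      then have "{j, i} = {j', i'}" "i \<le> j" "i' \<le> j'"
        using keys_g by (metis, auto simp: pairs_def)
      then show "j = j' \<and> i = i'" by (auto simp: doubleton_eq_iff)
    qed
  next
    fix m assume m: "m \<in> keys p"
    then have deg: "mon_degree m = 2" and vars: "keys m \<subseteq> {..<r}"
      using p by (auto simp: forms_def polys_iff)
    then have "m \<noteq> 0" by auto
    then obtain i n where n: "i \<in> keys m" "m = single i 1 + n" "keys n \<subseteq> keys m"
      "mon_degree m = Suc (mon_degree n)" by (rule exponent_split)
    then have "n \<noteq> 0" using deg by auto
    then obtain j k where k: "j \<in> keys n" "n = single j 1 + k" "mon_degree n = Suc (mon_degree k)"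
      by (rule exponent_split)
    then have "k = 0" using deg n(4) mon_degree_eq_0_iff by simp
    then have "m = g (i, j)" "m = g (j, i)" "i < r" "j < r"
      using n k vars by (auto simp: g_def add.commute)
    moreover have "(i, j) \<in> pairs r \<or> (j, i) \<in> pairs r"
      using \<open>i < r\<close> \<open>j < r\<close> by (auto simp: pairs_def)
    ultimately show "m \<in> g ` pairs r" by blast
  qed
  also have "\<dots> = (\<Sum>(j, i)\<in>pairs r. smul (lookup p (single j 1 + single i 1)) (var j * var i))"
    by (rule sum.cong) (auto simp: g_def var_def mult_single)
  finally show ?thesis .
qed

text \<open>The coefficients of a quadratic form can be read off at indicator vectors of sets with
  at most two elements: singletons give the squares, two-element sets then give the mixed
  terms.\<close>

lemma quadratic_nonzero_point:
  fixes \<delta> :: "nat \<times> nat \<Rightarrow> 'k::field"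
  assumes "\<exists>x\<in>pairs r. \<delta> x \<noteq> 0"
  shows "\<exists>v. (\<Sum>(j, i)\<in>pairs r. \<delta> (j, i) * (v j * v i)) \<noteq> 0"
proof (rule ccontr)
  assume "\<not> ?thesis"
  then have zero: "(\<Sum>(j, i)\<in>pairs r. \<delta> (j, i) * (v j * v i)) = 0" for v by blast
  \<comment> \<open>Evaluation at the indicator vector of \<open>A\<close>.\<close>
  have restrict: "(\<Sum>x\<in>pairs r \<inter> A \<times> A. \<delta> x) = 0" for A
  proof -
    have "(\<Sum>x\<in>pairs r \<inter> A \<times> A. \<delta> x)
        = (\<Sum>(j, i)\<in>pairs r. \<delta> (j, i) * ((if j \<in> A then 1 else 0) * (if i \<in> A then 1 else 0)))"
      by (subst sum.inter_restrict[OF finite_pairs]) (auto intro!: sum.cong)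
    then show ?thesis using zero by simp
  qed
  have diag: "\<delta> (i, i) = 0" if "i < r" for i
  proof -
    have "pairs r \<inter> {i} \<times> {i} = {(i, i)}" using that by (auto simp: pairs_def)
    then show ?thesis using restrict[of "{i}"] by simp
  qed
  from assms obtain j i where ji: "(j, i) \<in> pairs r" "\<delta> (j, i) \<noteq> 0" by auto
  then have "i < j" "j < r" using diag by (auto simp: pairs_def le_less)
  then have "pairs r \<inter> {i, j} \<times> {i, j} = {(i, i), (j, j), (j, i)}"
    by (auto simp: pairs_def)
  then show False
    using restrict[of "{i, j}"] diag \<open>i < j\<close> \<open>j < r\<close> ji(2) by simp
qed

text \<open>The parallelogram law shows that one of \<open>w\<close>, \<open>w + v\<close>, \<open>w - v\<close> will do if \<open>v\<close> does not.\<close>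

lemma common_nonzero_point:
  fixes \<delta> :: "nat \<times> nat \<Rightarrow> 'k::field_char_0"
  assumes v: "(\<Sum>(j, i)\<in>X. \<delta> (j, i) * (v j * v i)) \<noteq> 0" and w: "(\<Sum>i\<in>A. d i * w i) \<noteq> 0"
  shows "\<exists>u. (\<Sum>(j, i)\<in>X. \<delta> (j, i) * (u j * u i)) \<noteq> 0 \<and> (\<Sum>i\<in>A. d i * u i) \<noteq> 0"
proof (rule ccontr)
  define Q where "Q u = (\<Sum>(j, i)\<in>X. \<delta> (j, i) * (u j * u i))" for u :: "nat \<Rightarrow> 'k"
  define L where "L u = (\<Sum>i\<in>A. d i * u i)" for u :: "nat \<Rightarrow> 'k"
  assume "\<not> ?thesis"
  then have no: "Q u = 0 \<or> L u = 0" for u unfolding Q_def L_def by blast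
  have Lv: "L v = 0" using no[of v] v by (simp add: Q_def)
  have "L (\<lambda>i. w i + v i) = L w" "L (\<lambda>i. w i - v i) = L w"
    using Lv by (simp_all add: L_def distrib_left right_diff_distrib sum.distrib sum_subtractf)
  then have "Q w = 0" "Q (\<lambda>i. w i + v i) = 0" "Q (\<lambda>i. w i - v i) = 0"
    using no[of w] no[of "\<lambda>i. w i + v i"] no[of "\<lambda>i. w i - v i"] w unfolding L_def by metis+
  moreover have "Q (\<lambda>i. w i + v i) + Q (\<lambda>i. w i - v i) = 2 * Q w + 2 * Q v"
    unfolding Q_def sum_distrib_left sum.distrib[symmetric]
    by (rule sum.cong) (auto simp: algebra_simps)
  \<comment> \<open>The three vanishing values leave \<open>2 * Q v = 0\<close>, and 2 is invertible
    in characteristic zero.\<close>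
  ultimately show False using v by (simp add: Q_def)
qed

text \<open>Elementary form of a level algebra of socle degree three. The last clause says that the
  socle has no nonzero element in degrees below 3.\<close>

definition cubic_level_ideal :: "nat \<Rightarrow> nat \<Rightarrow> nat \<Rightarrow> 'k::field mpoly set \<Rightarrow> bool" where
  "cubic_level_ideal r a t I \<longleftrightarrow> ideal I (mpoly_ring r) \<and> I \<inter> forms r 1 = {0} \<and> t > 0 \<and>
     mp.quotient_dim (forms r 1) I r \<and> mp.quotient_dim (forms r 2) I a \<and> mp.quotient_dim (forms r 3) I t \<and>
     (\<forall>d p. d < 3 \<longrightarrow> p \<in> forms r d \<longrightarrow> (\<forall>i<r. var i * p \<in> I) \<longrightarrow> p \<in> I)"

lemma cubic_level_idealD:
  assumes "cubic_level_ideal r a t I"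
  shows "ideal I (mpoly_ring r)" "I \<inter> forms r 1 = {0}" "t > 0"
    "mp.quotient_dim (forms r 1) I r" "mp.quotient_dim (forms r 2) I a" "mp.quotient_dim (forms r 3) I t"
    "d < 3 \<Longrightarrow> p \<in> forms r d \<Longrightarrow> (\<And>i. i < r \<Longrightarrow> var i * p \<in> I) \<Longrightarrow> p \<in> I"
  using assms unfolding cubic_level_ideal_def by blast+

text \<open>The definition of a level h-vector leaves the number \<open>r'\<close> of variables
  open; it equals \<open>r\<close> because the variables form a basis of the linear forms modulo
  \<open>I\<close>. A socle form of degree below 3 is congruent to a cubic by levelness, hence lies
  in \<open>I\<close> by homogeneity.\<close>

lemma level_h_vector_imp_cubic_level_ideal:
  assumes "level_h_vector TYPE('k::field) [1, r, a, t]"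
  shows "\<exists>I :: 'k mpoly set. cubic_level_ideal r a t I"
proof -
  obtain r' and I :: "'k mpoly set" where std: "standard_graded_artinian r' I"
    and h: "has_h_vector r' I [1, r, a, t]" and level: "is_level r' I [1, r, a, t]"
    using assms by (auto simp: level_h_vector_def)
  have I: "ideal I (mpoly_ring r')" and hom: "\<And>p d. p \<in> I \<Longrightarrow> hom_component d p \<in> I"
    and I1: "I \<inter> forms r' 1 = {0}"
    using std by (auto simp: standard_graded_artinian_def homogeneous_ideal_def)
  have t: "t > 0" using h by (simp add: has_h_vector_def)
  have dim: "mp.quotient_dim (forms r' i) I ([1, r, a, t] ! i)" if "i < 4" for i
    using h that unfolding has_h_vector_def has_k_dim_quot_component[OF I] by simp
  have dim1: "mp.quotient_dim (forms r' 1) I r"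
    using dim[of 1] by simp
  then obtain e where "mp.basis_modulo (forms r' 1) I r e" by (rule mp.quotient_dimE)
  note e = mp.basis_moduloD[OF this]
  \<comment> \<open>Too many variables would give a nonzero linear form in \<open>I\<close>.\<close>
  have "r' \<le> r"
  proof (rule ccontr)
    assume "\<not> r' \<le> r"
    then have "\<exists>d. (\<exists>i\<in>{..<r'}. d i \<noteq> 0) \<and> (\<Sum>i<r'. smul (d i) (var i)) \<in> I"
      using e(3) var_forms
      by (intro mp.dependent_modulo[OF subspace_ideal[OF I], where Y = "{..<r}" and e = e]) auto
    then obtain d i where d: "(\<Sum>i<r'. smul (d i) (var i)) \<in> I" "i < r'" "d i \<noteq> 0" by auto
    have "(\<Sum>i<r'. smul (d i) (var i)) \<in> forms r' 1"
      using var_forms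
      by (intro mp.subspace_sum[OF subspace_forms] mp.subspace_scale[OF subspace_forms]) auto
    with d(1) I1 have "(\<Sum>i<r'. smul (d i) (var i)) = 0" by blast
    then have "lookup (\<Sum>i<r'. smul (d i) (var i)) (single i 1) = 0" by simp
    moreover have "lookup (smul (d k) (var k)) (single i 1) = (if k = i then d i else 0)" for k
      using single_1_eq_iff[of k i] by (simp add: var_def lookup_single when_def)
    ultimately show False using d by (simp add: lookup_sum)
  qed
  \<comment> \<open>Too few variables could not span the \<open>r\<close> independent classes of
    linear forms.\<close>
  moreover have "r \<le> r'"
  proof (rule ccontr)
    assume "\<not> r \<le> r'"
    moreover have "\<exists>c. p - (\<Sum>i<r'. smul (c i) (var i)) \<in> I" if "p \<in> forms r' 1" for p
    proof -
      have "p - (\<Sum>i<r'. smul (lookup p (single i 1)) (var i)) \<in> I"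
        using ideal_props(1)[OF I] var_form_expand[OF that, THEN right_minus_eq[THEN iffD2]]
        by (simp only:)
      then show ?thesis by (rule exI[of _ "\<lambda>i. lookup p (single i 1)"])
    qed
    ultimately have "\<exists>d. (\<exists>i\<in>{..<r}. d i \<noteq> 0) \<and> (\<Sum>i<r. smul (d i) (e i)) \<in> I"
      using e(1)
      by (intro mp.dependent_modulo[OF subspace_ideal[OF I], where Y = "{..<r'}" and e = var]) auto
    then obtain d i where "(\<Sum>i<r. smul (d i) (e i)) \<in> I" "i < r" "d i \<noteq> 0" by auto
    then show False using e(2)[of d i] by simp
  qed
  ultimately have r: "r' = r" by simp
  have "p \<in> I" if d: "d < 3" and p: "p \<in> forms r d" and var: "\<forall>i<r. var i * p \<in> I" for d p
  proof -
    have "I +>\<^bsub>mpoly_ring r\<^esub> p \<in> socle r I"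
      using I var unfolding r by (intro var_multiples_imp_mem_socle forms_polys[OF p]) auto
    then have "I +>\<^bsub>mpoly_ring r\<^esub> p \<in> quot_component r I 3"
      using level unfolding is_level_def r by (auto simp: numeral_3_eq_3)
    then obtain q where q: "q \<in> forms r 3" "p - q \<in> I"
      using coset_eq_iff[OF I] unfolding r by (auto simp: quot_component_def)
    \<comment> \<open>Since \<open>d < 3\<close>, the cubic \<open>q\<close> has no part in degree
      \<open>d\<close>.\<close>
    have "hom_component d (p - q) = p"
      using d by (simp add: hom_component_diff hom_component_form[OF p] hom_component_form[OF q(1)])
    then show "p \<in> I" using hom[OF q(2), of d] by simp
  qed
  then have "cubic_level_ideal r a t I"
    using I I1 t dim1 dim[of 2] dim[of 3] unfolding cubic_level_ideal_def r by simp
  then show ?thesis by blast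
qed

section \<open>Functionals on quadrics and the upper bounds\<close>

lemma linear_form_on_mult_form:
  assumes "mp.linear_form_on (forms r n) \<phi>" "f \<in> forms r d" "n = d + d'"
  shows "mp.linear_form_on (forms r d') (\<lambda>p. \<phi> (f * p))"
  using assms(1) forms_mult[OF assms(2) _ assms(3)]
  by (auto simp: mp.linear_form_on_def distrib_left smul_mult_right)

lemma var_mult_linear: "i < r \<Longrightarrow> p \<in> forms r 1 \<Longrightarrow> var i * p \<in> forms r 2"
  by (rule forms_mult[OF var_forms]) auto

lemma var_mult_quadratic: "i < r \<Longrightarrow> p \<in> forms r 2 \<Longrightarrow> var i * p \<in> forms r 3"
  by (rule forms_mult[OF var_forms]) auto

lemma var_pair_forms: "x \<in> pairs r \<Longrightarrow> var (fst x) * var (snd x) \<in> forms r 2"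
  by (intro var_mult_linear var_forms) (auto simp: pairs_def)

lemma linear_form_on_sum_mult:
  assumes "finite X" "\<And>x. x \<in> X \<Longrightarrow> mp.linear_form_on S (\<psi> x)"
  shows "mp.linear_form_on S (\<lambda>p. \<Sum>x\<in>X. d x * \<psi> x p)"
  using assms
  by (simp add: mp.linear_form_on_def distrib_left sum.distrib sum_distrib_left mult.left_commute)

text \<open>By levelness the \<open>r * t\<close> functionals taking \<open>p\<close> to
  \<open>\<phi> j (var i * p)\<close> separate quadrics modulo \<open>I\<close>, which gives the
  first bound; the second counts quadratic monomials.\<close>

lemma cubic_level_ideal_upper_bound:
  assumes "cubic_level_ideal r b t I"
  shows "b \<le> r * t" "b \<le> (r + 1) choose 2"
proof -
  note level = cubic_level_idealD[OF assms]
  note I = level(1)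
  from level(5) obtain e where "mp.basis_modulo (forms r 2) I b e" by (rule mp.quotient_dimE)
  note e = mp.basis_moduloD[OF this]
  obtain e3 \<phi> where "mp.dual_basis (forms r 3) I t e3 \<phi>"
    using mp.quotient_dim_imp_dual_basis[OF subspace_forms subspace_ideal[OF I] level(6)] by blast
  note \<phi> = mp.dual_basisD[OF this]
  show "b \<le> r * t"
  proof (rule ccontr)
    assume "\<not> b \<le> r * t"
    then obtain c where c: "\<exists>k\<in>{..<b}. c k \<noteq> 0"
      "\<And>i j. i < r \<Longrightarrow> j < t \<Longrightarrow> (\<Sum>k<b. c k * \<phi> j (var i * e k)) = 0"
      using underdetermined_system[of "{..<r} \<times> {..<t}" "{..<b}" "\<lambda>(i, j) k. \<phi> j (var i * e k)"]
      by auto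
    define p where "p = (\<Sum>k<b. smul (c k) (e k))"
    have p: "p \<in> forms r 2" unfolding p_def using e(1)
      by (intro mp.subspace_sum[OF subspace_forms] mp.subspace_scale[OF subspace_forms]) auto
    have "var i * p \<in> I" if i: "i < r" for i
    proof -
      have "\<phi> j (var i * p) = 0" if j: "j < t" for j
      proof -
        have "mp.linear_form_on (forms r 2) (\<lambda>p. \<phi> j (var i * p))"
          by (rule linear_form_on_mult_form[OF \<phi>(2)[OF j] var_forms[OF i]]) simp
        from mp.linear_form_on_sum[OF this subspace_forms, of "{..<b}" e c] show ?thesis
          unfolding p_def using e(1) c(2)[OF i j] by simp
      qed
      then show ?thesis using \<phi>(4)[OF var_mult_quadratic[OF i p]] by simp
    qed
    then have "p \<in> I" by (intro level(7)[OF _ p]) auto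
    moreover from c(1) obtain k where "k < b" "c k \<noteq> 0" by auto
    ultimately show False using e(2)[of c k] unfolding p_def by simp
  qed
  show "b \<le> (r + 1) choose 2"
  proof (rule ccontr)
    assume "\<not> b \<le> (r + 1) choose 2"
    moreover have "\<exists>c. p - (\<Sum>x\<in>pairs r. smul (c x) (var (fst x) * var (snd x))) \<in> I" if "p \<in> forms r 2" for p
    proof -
      have "p - (\<Sum>x\<in>pairs r. smul (lookup p (single (fst x) 1 + single (snd x) 1)) (var (fst x) * var (snd x))) \<in> I"
        using ideal_props(1)[OF I] quadratic_form_expand[OF that, THEN right_minus_eq[THEN iffD2]]
        by (simp only: case_prod_unfold)
      then show ?thesis by (rule exI[of _ "\<lambda>x. lookup p (single (fst x) 1 + single (snd x) 1)"])
    qed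
    ultimately have "\<exists>d. (\<exists>i\<in>{..<b}. d i \<noteq> 0) \<and> (\<Sum>i<b. smul (d i) (e i)) \<in> I"
      using e(1) by (intro mp.dependent_modulo[OF subspace_ideal[OF I] _ finite_pairs[of r],
          where e = "\<lambda>x. var (fst x) * var (snd x)"]) (auto simp: card_pairs)
    then obtain d i where "(\<Sum>i<b. smul (d i) (e i)) \<in> I" "i < b" "d i \<noteq> 0" by auto
    then show False using e(2)[of d i] by simp
  qed
qed

text \<open>The new ideal is \<open>macaulay_ideal r 3 t \<phi>'\<close>. Degree 2 gains one
  dimension because its quadrics are those of \<open>I\<close> vanishing at \<open>v\<close>;
  degrees 0, 1 and 3 keep their dimensions.\<close>

lemma level_h_vector_Suc:
  assumes level: "level_h_vector TYPE('k::field_char_0) [1, r, a, t]"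
    and a: "a < r * t" "a < (r + 1) choose 2"
  shows "level_h_vector TYPE('k) [1, r, Suc a, t]"
proof -
  obtain I :: "'k mpoly set" where "cubic_level_ideal r a t I"
    using level_h_vector_imp_cubic_level_ideal[OF level] by blast
  note I = cubic_level_idealD[OF this]
  note sub = subspace_ideal[OF I(1)]
  obtain e \<phi> where "mp.dual_basis (forms r 3) I t e \<phi>"
    using mp.quotient_dim_imp_dual_basis[OF subspace_forms sub I(6)] by blast
  note \<phi> = mp.dual_basisD[OF this]
  from I(5) obtain e2 where "mp.basis_modulo (forms r 2) I a e2" by (rule mp.quotient_dimE)
  note e2 = mp.basis_moduloD[OF this]

  have \<phi>_var: "mp.linear_form_on (forms r 2) (\<lambda>p. \<phi> j (var i * p))" if "j < t" "i < r" for i j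
    by (rule linear_form_on_mult_form[OF \<phi>(2)[OF that(1)] var_forms[OF that(2)]]) simp

  \<comment> \<open>There are more than \<open>a\<close> quadratic monomials, so some nontrivial
    combination lies in \<open>I\<close>. Its coefficients are kept for the choice of
    \<open>v\<close>.\<close>
  obtain \<delta> where \<delta>: "\<exists>x\<in>pairs r. \<delta> x \<noteq> 0" "(\<Sum>x\<in>pairs r. smul (\<delta> x) (var (fst x) * var (snd x))) \<in> I"
  proof -
    have "\<exists>d. (\<exists>x\<in>pairs r. d x \<noteq> 0) \<and> (\<Sum>x\<in>pairs r. smul (d x) (var (fst x) * var (snd x))) \<in> I"
    proof (rule mp.dependent_modulo[OF sub finite_pairs finite_lessThan[of a]])
      show "card {..<a} < card (pairs r)" using a(2) by (simp add: card_pairs)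
    qed (rule e2(3)[OF var_pair_forms])
    then show thesis using that by blast
  qed
  define p0 :: "'k mpoly" where "p0 = (\<Sum>x\<in>pairs r. smul (\<delta> x) (var (fst x) * var (snd x)))"
  have p0: "p0 \<in> I" "p0 \<in> forms r 2"
  proof -
    show "p0 \<in> I" using \<delta>(2) by (simp add: p0_def)
    show "p0 \<in> forms r 2" unfolding p0_def
      by (intro mp.subspace_sum[OF subspace_forms] mp.subspace_scale[OF subspace_forms] var_pair_forms)
  qed
  have eval_p0: "eval_poly v p0 = (\<Sum>(j, i)\<in>pairs r. \<delta> (j, i) * (v j * v i))" for v
    by (simp add: p0_def eval_poly_sum eval_poly_smul eval_poly_mult eval_poly_var case_prod_unfold)

  \<comment> \<open>There are \<open>r * t > a\<close> functionals \<open>\<lambda>p. \<phi> j (var i * p)\<close> on a space of dimension \<open>a\<close>.\<close>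
  obtain d i0 j0 where d: "i0 < r" "j0 < t" "d (i0, j0) \<noteq> 0"
    and rel_e2: "\<And>k. k < a \<Longrightarrow> (\<Sum>x\<in>{..<r} \<times> {..<t}. d x * \<phi> (snd x) (var (fst x) * e2 k)) = 0"
    using underdetermined_system[of "{..<a}" "{..<r} \<times> {..<t}" "\<lambda>k x. \<phi> (snd x) (var (fst x) * e2 k)"] a(1)
    by auto
  \<comment> \<open>The relation is known on the basis \<open>e2\<close>. It extends because every
    \<open>\<phi> j\<close> kills the multiples \<open>var i * p\<close> of a quadric
    \<open>p\<close> in \<open>I\<close>.\<close>
  have rel: "(\<Sum>x\<in>{..<r} \<times> {..<t}. d x * \<phi> (snd x) (var (fst x) * p)) = 0" if p: "p \<in> forms r 2" for p
  proof -
    define F where "F p = (\<Sum>x\<in>{..<r} \<times> {..<t}. d x * \<phi> (snd x) (var (fst x) * p))" for p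
    have F: "mp.linear_form_on (forms r 2) F"
      unfolding F_def by (rule linear_form_on_sum_mult) (auto intro: \<phi>_var)
    obtain c where c: "p - (\<Sum>k<a. smul (c k) (e2 k)) \<in> I" using e2(3)[OF p] by blast
    define s where "s = (\<Sum>k<a. smul (c k) (e2 k))"
    have s: "s \<in> forms r 2" unfolding s_def using e2(1)
      by (intro mp.subspace_sum[OF subspace_forms] mp.subspace_scale[OF subspace_forms]) auto
    have ps: "p - s \<in> forms r 2" by (rule mp.subspace_diff[OF subspace_forms p s])
    have "\<phi> j (var i * (p - s)) = 0" if "i < r" "j < t" for i j
    proof -
      have "var i * (p - s) \<in> I"
        using ideal_props(4)[OF I(1) c forms_polys[OF var_forms[OF that(1)]]] by (simp only: s_def)
      then show ?thesis using \<phi>(4)[OF var_mult_quadratic[OF that(1) ps]] that(2) by simp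
    qed
    then have "F (p - s) = 0" unfolding F_def by (intro sum.neutral) auto
    moreover have "F s = 0"
      unfolding s_def using mp.linear_form_on_sum[OF F subspace_forms, of "{..<a}" e2 c] e2(1) rel_e2
      by (simp add: F_def)
    moreover have "F (p - s) = F p - F s" by (rule mp.linear_form_on_diff[OF F subspace_forms p s])
    ultimately show ?thesis by (simp add: F_def)
  qed

  \<comment> \<open>One point avoids the zeros of \<open>p0\<close>, and the unit vector at
    \<open>i0\<close> avoids those of the linear form; a common point results from the two.\<close>
  obtain v where v: "eval_poly v p0 \<noteq> 0" "(\<Sum>i<r. d (i, j0) * v i) \<noteq> 0"
  proof -
    obtain u where u: "(\<Sum>(j, i)\<in>pairs r. \<delta> (j, i) * (u j * u i)) \<noteq> 0"
      using quadratic_nonzero_point[OF \<delta>(1)] by blast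
    have "(\<Sum>i<r. d (i, j0) * (if i = i0 then 1 else 0)) = (\<Sum>i<r. if i = i0 then d (i, j0) else 0)"
      by (rule sum.cong) auto
    then have "(\<Sum>i<r. d (i, j0) * (if i = i0 then 1 else 0)) \<noteq> 0" using d by simp
    from common_nonzero_point[OF u this] show thesis
      using that unfolding eval_p0 by blast
  qed
  \<comment> \<open>A linear form that is nonzero at \<open>v\<close> forces a nonzero coordinate,
    which is needed as a divisor.\<close>
  then obtain i1 where i1: "i1 < r" "v i1 \<noteq> 0"
    by (metis (no_types, lifting) lessThan_iff mult_zero_right sum.neutral)
  \<comment> \<open>All \<open>\<phi> j\<close> vanish at \<open>q\<close> but evaluation at \<open>v\<close> does not, which keeps the new functionals independent.\<close>
  define q where "q = smul (1 / (v i1 * eval_poly v p0)) (var i1 * p0)"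
  have q: "q \<in> forms r 3" "q \<in> I" "eval_poly v q = 1"
  proof -
    show "q \<in> forms r 3"
      unfolding q_def by (intro mp.subspace_scale[OF subspace_forms] var_mult_quadratic i1(1) p0(2))
    show "q \<in> I"
      unfolding q_def by (intro mp.subspace_scale[OF sub] ideal_props(4)[OF I(1) p0(1)] forms_polys[OF var_forms] i1(1))
    show "eval_poly v q = 1"
      using i1(2) v(1) by (simp add: q_def eval_poly_smul eval_poly_mult eval_poly_var)
  qed

  define \<phi>' where "\<phi>' j p = \<phi> j p + (if j = j0 then eval_poly v p else 0)" for j p
  \<comment> \<open>Since \<open>q\<close> lies in \<open>I\<close> and evaluates to 1, subtracting
    this multiple makes the evaluation vanish without changing the old coordinates, so duality
    survives.\<close>
  define e' where "e' k = e k - smul (eval_poly v (e k)) q" for k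
  have \<phi>'_lin: "mp.linear_form_on (forms r 3) (\<phi>' j)" if "j < t" for j
    using \<phi>(2)[OF that] unfolding \<phi>'_def
    by (auto simp: mp.linear_form_on_def eval_poly_add eval_poly_smul algebra_simps)
  then interpret inverse_system r 3 t \<phi>' by unfold_locales
  have e'_forms: "e' k \<in> forms r 3" if "k < t" for k
    unfolding e'_def
    by (intro mp.subspace_diff[OF subspace_forms] mp.subspace_scale[OF subspace_forms] \<phi>(1)[OF that] q(1))
  have eval_e': "eval_poly v (e' k) = 0" for k
  proof -
    have "eval_poly v (e' k) = eval_poly v (e k) - eval_poly v (smul (eval_poly v (e k)) q)"
      unfolding e'_def by (rule mp.linear_form_on_diff[OF linear_form_on_eval_poly mp.subspace_UNIV]) auto
    then show ?thesis by (simp add: eval_poly_smul q(3))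
  qed
  have dual': "\<phi>' j (e' k) = (if j = k then 1 else 0)" if j: "j < t" and k: "k < t" for j k
  proof -
    have "\<phi> j (e' k) = \<phi> j (e k) - \<phi> j (smul (eval_poly v (e k)) q)"
      unfolding e'_def
      by (intro mp.linear_form_on_diff[OF \<phi>(2)[OF j] subspace_forms] \<phi>(1)[OF k]
          mp.subspace_scale[OF subspace_forms] q(1))
    moreover have "\<phi> j (smul (eval_poly v (e k)) q) = 0"
      using mp.linear_form_onD(2)[OF \<phi>(2)[OF j] q(1)] \<phi>(4)[OF q(1)] q(2) j by simp
    ultimately show ?thesis by (simp add: \<phi>'_def eval_e' \<phi>(3)[OF j k])
  qed

  \<comment> \<open>Multipliers from degree 3 to degree 3 are constants, so the functionals alone
    decide membership.\<close>
  have cubics: "p \<in> M \<longleftrightarrow> (\<forall>j<t. \<phi>' j p = 0)" if p: "p \<in> forms r 3" for p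
  proof
    assume "p \<in> M"
    then show "\<forall>j<t. \<phi>' j p = 0"
      using M_D[of p 1] hom_component_form[OF p, of 3] by simp
  next
    assume zero: "\<forall>j<t. \<phi>' j p = 0"
    have "\<phi>' j (f * p) = 0" if f: "f \<in> forms r 0" and j: "j < t" for f j
    proof -
      have "f * p = smul (lookup f 0) p"
        by (subst forms_0D[OF f]) (simp add: smul_mult_left)
      then show ?thesis using mp.linear_form_onD(2)[OF \<phi>'_lin[OF j] p] zero j by simp
    qed
    then show "p \<in> M" using forms_mem_M_iff[OF p, simplified] by blast
  qed
  have dim3: "mp.quotient_dim (forms r 3) M t"
  proof (rule mp.dual_basis_imp_quotient_dim[OF subspace_forms])
    show "mp.dual_basis (forms r 3) M t e' \<phi>'"
      unfolding mp.dual_basis_def using e'_forms \<phi>'_lin dual' cubics by blast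
  qed

  have quadrics: "p \<in> M \<longleftrightarrow> p \<in> I \<and> eval_poly v p = 0" if p: "p \<in> forms r 2" for p
  proof
    assume pM: "p \<in> M"
    \<comment> \<open>Membership in \<open>M\<close> forces
      \<open>\<phi>' j (var i * p) = 0\<close>, where evaluation at \<open>v\<close> enters for
      \<open>j0\<close> only.\<close>
    have zero: "\<phi> j (var i * p) = - (if j = j0 then v i * eval_poly v p else 0)" if "i < r" "j < t" for i j
    proof -
      have "var i * p \<in> M"
        by (rule ideal_props(4)[OF ideal_M pM forms_polys[OF var_forms[OF that(1)]]])
      then have "\<phi>' j (var i * p) = 0"
        using cubics[OF var_mult_quadratic[OF that(1) p]] that(2) by blast
      then show ?thesis
        by (cases "j = j0") (simp_all add: \<phi>'_def eval_poly_mult eval_poly_var eq_neg_iff_add_eq_0)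
    qed
    have "0 = (\<Sum>x\<in>{..<r} \<times> {..<t}. d x * \<phi> (snd x) (var (fst x) * p))"
      by (rule rel[OF p, symmetric])
    also have "\<dots> = (\<Sum>i<r. \<Sum>j<t. d (i, j) * \<phi> j (var i * p))"
      by (simp add: sum.cartesian_product case_prod_unfold)
    also have "\<dots> = (\<Sum>i<r. \<Sum>j<t. if j = j0 then - (d (i, j) * v i * eval_poly v p) else 0)"
      by (intro sum.cong refl) (auto simp: zero)
    \<comment> \<open>Only \<open>j = j0\<close> survives; the sum that remains is the linear form
      at \<open>v\<close>, which is nonzero by the choice of \<open>v\<close>.\<close>
    also have "\<dots> = - ((\<Sum>i<r. d (i, j0) * v i) * eval_poly v p)"
      using d(2) by (simp add: sum_negf sum_distrib_right)
    finally have eval: "eval_poly v p = 0" using v(2) by simp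
    moreover have "p \<in> I"
    proof (rule I(7)[OF _ p])
      fix i assume i: "i < r"
      show "var i * p \<in> I"
        using \<phi>(4)[OF var_mult_quadratic[OF i p]] zero[OF i] eval by simp
    qed simp
    ultimately show "p \<in> I \<and> eval_poly v p = 0" by simp
  next
    assume pI: "p \<in> I \<and> eval_poly v p = 0"
    have "\<phi>' j (f * p) = 0" if f: "f \<in> forms r 1" and j: "j < t" for f j
    proof -
      have "f * p \<in> forms r 3" by (rule forms_mult[OF f p]) simp
      moreover have "f * p \<in> I" using ideal_props(4)[OF I(1) _ forms_polys[OF f]] pI by blast
      ultimately have "\<phi> j (f * p) = 0" using \<phi>(4) j by blast
      then show ?thesis using pI by (simp add: \<phi>'_def eval_poly_mult)
    qed
    moreover have "3 - 2 = (1::nat)" by simp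
    ultimately show "p \<in> M" using forms_mem_M_iff[OF p] by (simp only:) simp
  qed
  have dim2: "mp.quotient_dim (forms r 2) M (Suc a)"
    by (rule mp.quotient_dim_Suc[OF subspace_forms sub I(5) linear_form_on_eval_poly p0(2,1) v(1) quadrics])

  \<comment> \<open>The products of such a form with the variables are quadrics of \<open>M\<close>,
    hence lie in \<open>I\<close>; levelness of \<open>I\<close> then puts the form itself in
    \<open>I\<close>.\<close>
  have linear: "M \<inter> forms r 1 = {0}"
  proof (intro equalityI subsetI)
    fix p assume p: "p \<in> M \<inter> forms r 1"
    have "var i * p \<in> I" if i: "i < r" for i
    proof -
      have "var i * p \<in> forms r 2" using var_mult_linear[OF i] p by blast
      moreover have "var i * p \<in> M"
        using ideal_props(4)[OF ideal_M _ forms_polys[OF var_forms[OF i]]] p by blast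
      ultimately show ?thesis using quadrics by blast
    qed
    then have "p \<in> I" using I(7)[of 1 p] p by simp
    then show "p \<in> {0}" using I(2) p by blast
  qed (use ideal_props(1)[OF ideal_M] mp.subspace_0[OF subspace_forms] in simp)
  \<comment> \<open>Both ideals meet the linear forms in zero only, so the old dimension
    transfers.\<close>
  then have dim1: "mp.quotient_dim (forms r 1) M r"
    using I(4) mp.quotient_dim_cong[OF subspace_forms, of M r 1 I] I(2) by simp

  \<comment> \<open>A nonzero constant cannot lie in \<open>M\<close>: its product with the cubic
    \<open>e' 0\<close>, available since \<open>t > 0\<close>, has a nonzero value under
    \<open>\<phi>' 0\<close>.\<close>
  have dim0: "mp.quotient_dim (forms r 0) M 1"
  proof (rule mp.dual_basis_imp_quotient_dim[OF subspace_forms])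
    have "p \<in> M \<longleftrightarrow> lookup p 0 = 0" if p: "p \<in> forms r 0" for p
    proof
      assume pM: "p \<in> M"
      have eq: "e' 0 * p = smul (lookup p 0) (e' 0)"
        by (subst forms_0D[OF p]) (simp add: smul_mult_right)
      have "\<phi>' 0 (e' 0 * p) = 0"
        using forms_mem_M_iff[OF p] pM e'_forms I(3) by simp
      then show "lookup p 0 = 0"
        using mp.linear_form_onD(2)[OF \<phi>'_lin[OF I(3)] e'_forms[OF I(3)]] dual'[OF I(3) I(3)]
        by (simp add: eq)
    next
      assume "lookup p 0 = 0"
      then have "p = 0" using forms_0D[OF p] by simp
      then show "p \<in> M" using ideal_props(1)[OF ideal_M] by simp
    qed
    then show "mp.dual_basis (forms r 0) M 1 (\<lambda>_. 1) (\<lambda>_ p. lookup p 0)"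
      by (simp add: mp.dual_basis_def one_forms mp.linear_form_on_def lookup_add)
  qed

  show ?thesis
  proof (rule level_h_vector_M[OF _ _ linear])
    fix i :: nat assume "i \<le> 3"
    then consider "i = 0" | "i = 1" | "i = 2" | "i = 3" by linarith
    then show "mp.quotient_dim (forms r i) M ([1, r, Suc a, t] ! i)"
      using dim0 dim1 dim2 dim3 by cases simp_all
  qed (use I(3) in simp_all)
qed

theorem theorem3p7:
  fixes r a t :: nat
  assumes "level_h_vector TYPE('k::field_char_0) [1, r, a, t]"
    and "int t \<ge> int r - 2"
  shows "(\<forall>b. a \<le> b \<and> b \<le> min (r * t) ((r + 1) choose 2)
              \<longrightarrow> level_h_vector TYPE('k) [1, r, b, t]) \<and>
         (\<forall>b. b > min (r * t) ((r + 1) choose 2)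
              \<longrightarrow> \<not> level_h_vector TYPE('k) [1, r, b, t])"
proof (intro conjI allI impI)
  fix b assume b: "a \<le> b \<and> b \<le> min (r * t) ((r + 1) choose 2)"
  then have "a \<le> b" by simp
  then show "level_h_vector TYPE('k) [1, r, b, t]"
    using b
  proof (induction b rule: dec_induct)
    case base
    show ?case by (rule assms(1))
  next
    case (step n)
    \<comment> \<open>Since \<open>n < b\<close>, the entry \<open>n\<close> is strictly below both
      bounds.\<close>
    then show ?case by (intro level_h_vector_Suc step.IH) auto
  qed
next
  fix b assume b: "b > min (r * t) ((r + 1) choose 2)"
  show "\<not> level_h_vector TYPE('k) [1, r, b, t]"
  proof
    assume "level_h_vector TYPE('k) [1, r, b, t]"
    then obtain I :: "'k mpoly set" where "cubic_level_ideal r b t I"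
      using level_h_vector_imp_cubic_level_ideal by blast
    from cubic_level_ideal_upper_bound[OF this] b show False by simp
  qed
qed

end
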